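(* Let $p$ be a continuous probability density supported on a compact set $\mathcal{X}\subset\mathbb{R}^D$ with $\inf_{\mathbf{x}\in\mathcal{X}}p(\mathbf{x})\ge\delta$ for some constant $\delta>0$, and let $\mathbf{X}\sim p$. Call a map $\Psi:\mathbb{R}^D\to\mathbb{R}^D$ a marginal Gaussianization layer if for each coordinate $i=1,\dots,D$ there are an integer $N_i\ge1$ and constants $\mu_{ij}\in\mathbb{R}$, $\sigma_{ij}>0$ ($j=1,\dots,N_i$) such that $$\Psi_i(\mathbf{x})=\Phi^{-1}\!\left(\frac{1}{N_i}\sum_{j=1}^{N_i}\sigma\!\left(\frac{x_i-\mu_{ij}}{\sigma_{ij}}\right)\right),$$ where $x_i$ is the $i$-th coordinate of $\mathbf{x}$. Then there exist a sequence of marginal Gaussianization layers $\Psi^{(1)},\Psi^{(2)},\dots$ and a sequence of $D\times D$ orthogonal (rotation) matrices $R^{(1)},R^{(2)},\dots$ such that the random vectors $$\mathbf{X}^{(k)}=\Psi^{(k)}\big(R^{(k)}\,\Psi^{(k-1)}\big(R^{(k-1)}\cdots\Psi^{(1)}(R^{(1)}\mathbf{X})\big)\big)$$ converge in distribution to $\mathcal{N}(\mathbf{0},\mathbf{I}_D)$ as $k\to\infty$.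
   Context: $\sigma(t)=1/(1+e^{-t})$ is the sigmoid function; $\Phi$ is the CDF of the univariate standard normal distribution and $\Phi^{-1}$ its inverse; $\mathcal{N}(\mathbf{0},\mathbf{I}_D)$ is the $D$-dimensional standard Gaussian. *)

theory Defs
  imports "HOL-Probability.Probability"
begin

definition sigmoid :: "real \<Rightarrow> real" where
  "sigmoid t = 1 / (1 + exp (- t))"

definition Phi :: "real \<Rightarrow> real" where
  "Phi x = measure (density lborel std_normal_density) {..x}"

definition Phi_inv :: "real \<Rightarrow> real" where
  "Phi_inv y = (THE x. Phi x = y)"

definition std_gaussian :: "(real^'n) measure" where
  "std_gaussian = density lborel (\<lambda>x. \<Prod>i\<in>UNIV. std_normal_density (x $ i))"

definition marginal_gaussianization_layer :: "(real^'n \<Rightarrow> real^'n) \<Rightarrow> bool" where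
  "marginal_gaussianization_layer \<Psi> \<longleftrightarrow>
     (\<forall>i. \<exists>(N::nat) (\<mu>::nat \<Rightarrow> real) (s::nat \<Rightarrow> real).
        N \<ge> 1 \<and> (\<forall>j\<in>{1..N}. s j > 0) \<and>
        (\<forall>x. \<Psi> x $ i = Phi_inv ((1 / real N) * (\<Sum>j=1..N. sigmoid ((x $ i - \<mu> j) / s j)))))"

fun flow :: "(nat \<Rightarrow> real^'n \<Rightarrow> real^'n) \<Rightarrow> (nat \<Rightarrow> real^'n^'n) \<Rightarrow> nat \<Rightarrow> real^'n \<Rightarrow> real^'n" where
  "flow \<Psi> R 0 x = x"
| "flow \<Psi> R (Suc k) x = \<Psi> (Suc k) (R (Suc k) *v flow \<Psi> R k x)"

definition conv_in_distribution :: "(nat \<Rightarrow> (real^'n) measure) \<Rightarrow> (real^'n) measure \<Rightarrow> bool" where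
  "conv_in_distribution M L \<longleftrightarrow>
     (\<forall>f :: real^'n \<Rightarrow> real. continuous_on UNIV f \<and> bounded (range f) \<longrightarrow>
        (\<lambda>k. integral\<^sup>L (M k) f) \<longlonglongrightarrow> integral\<^sup>L L f)"

end

theory Submission
  imports Defs
begin

text \<open>
  A layer preceded by a rotation pushes some law with an explicit density \<open>exp G\<close> relative to
  the standard Gaussian \<open>\<gamma>\<close> forward to \<open>\<gamma>\<close>, where \<open>G\<close> is the sum of the functions
  \<open>ln (f\<^sub>i / \<phi>)\<close> of the rotated coordinates, \<open>f\<^sub>i\<close> being the logistic mixture densities and \<open>\<phi>\<close>
  the normal density. Along a composition \<open>T\<^sub>k\<close> of such steps the exponents add up to a function
  \<open>W\<^sub>k\<close> with \<open>\<integral> exp W\<^sub>k d\<gamma> = 1\<close>. If the law of \<open>X\<close> has a density bounded by \<open>Q\<close> relative to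
  \<open>\<gamma>\<close>, then \<open>E W\<^sub>k \<le> E exp W\<^sub>k \<le> Q\<close>, so the total gain of the steps is bounded.

  Choose each step to be optimal up to \<open>2\<^sup>-\<^sup>k\<close>. Then the largest gain still available at time \<open>k\<close>
  tends to \<open>0\<close>. Logistic mixtures approximate every positive continuous density from below on
  compact sets, in particular \<open>\<phi> (1 + \<eta> (h - \<integral> h \<phi>))\<close> in an arbitrary direction \<open>\<theta>\<close>, and for small
  \<open>\<eta>\<close> the vanishing of its gain forces \<open>E h(\<theta> \<bullet> T\<^sub>k X) \<rightarrow> \<integral> h \<phi>\<close>. Convergence of all
  one-dimensional projections gives convergence in distribution.
\<close>

section \<open>Rotation invariance of the Gaussian\<close>

text \<open>Tonelli over the coordinates: the basis of \<open>real^'n\<close> consists of the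
  vectors \<open>axis i 1\<close>, so a product over \<open>Basis\<close> is reindexed along this
  injection.\<close>

lemma nn_integral_lborel_vec_prod:
  fixes f :: "'n::finite \<Rightarrow> real \<Rightarrow> ennreal"
  assumes "\<And>i. f i \<in> borel_measurable borel"
  shows "(\<integral>\<^sup>+x. (\<Prod>i\<in>UNIV. f i (x $ i)) \<partial>(lborel :: (real^'n) measure)) =
    (\<Prod>i\<in>UNIV. \<integral>\<^sup>+x. f i x \<partial>lborel)"
proof -
  let ?e = "\<lambda>i::'n. axis i (1::real)"
  have inj: "inj ?e"
    by (auto simp: inj_on_def axis_eq_axis)
  have B: "(Basis :: (real^'n) set) = range ?e"
    by (auto simp: Basis_vec_def)
  have "(\<integral>\<^sup>+x. (\<Prod>b\<in>Basis. f (inv ?e b) (x \<bullet> b)) \<partial>(lborel :: (real^'n) measure)) =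
      (\<Prod>b\<in>(Basis :: (real^'n) set). \<integral>\<^sup>+x. f (inv ?e b) x \<partial>lborel)"
    by (rule nn_integral_lborel_prod) (auto intro: assms)
  then show ?thesis
    unfolding B by (simp add: prod.reindex[OF inj] inv_f_f[OF inj] inner_axis)
qed

lemma nn_integral_lborel_translate:
  fixes f :: "'a::euclidean_space \<Rightarrow> ennreal"
  assumes [measurable]: "f \<in> borel_measurable borel"
  shows "(\<integral>\<^sup>+x. f (c + x) \<partial>lborel) = (\<integral>\<^sup>+x. f x \<partial>lborel)"
proof -
  have "(\<integral>\<^sup>+x. f x \<partial>lborel) = (\<integral>\<^sup>+x. f x \<partial>(distr lborel borel ((+) c)))"
    by (simp add: lborel_distr_plus)
  also have "\<dots> = (\<integral>\<^sup>+x. f (c + x) \<partial>lborel)"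
    by (rule nn_integral_distr) auto
  finally show ?thesis by simp
qed

lemma nn_integral_lborel_reflect:
  fixes f :: "'a::euclidean_space \<Rightarrow> ennreal"
  assumes [measurable]: "f \<in> borel_measurable borel"
  shows "(\<integral>\<^sup>+x. f (c - x) \<partial>lborel) = (\<integral>\<^sup>+x. f x \<partial>lborel)"
proof -
  have "lborel = distr lborel borel (\<lambda>x::'a. c - x)"
    using lborel_affine[of "-1" c] by (simp add: density_1)
  then have "(\<integral>\<^sup>+x. f x \<partial>lborel) = (\<integral>\<^sup>+x. f x \<partial>(distr lborel borel (\<lambda>x. c - x)))"
    by simp
  also have "\<dots> = (\<integral>\<^sup>+x. f (c - x) \<partial>lborel)"
    by (rule nn_integral_distr) auto
  finally show ?thesis by simp
qed

text \<open>The point of this form is that the density depends on \<open>x\<close> through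
  \<open>x \<bullet> x\<close> only, which orthogonal matrices preserve.\<close>

lemma std_normal_density_prod:
  fixes x :: "real^'n"
  shows "(\<Prod>i\<in>UNIV. std_normal_density (x $ i)) = (1 / sqrt (2 * pi)) ^ CARD('n) * exp (- (x \<bullet> x) / 2)"
  by (simp add: std_normal_density_def prod.distrib exp_sum[symmetric] inner_vec_def
      power2_eq_square sum_divide_distrib sum_negf prod_dividef power_divide)

lemma matrix_mult_borel_measurable [measurable]:
  fixes R :: "real^'n^'n"
  shows "(\<lambda>x. R *v x) \<in> borel_measurable borel"
  by (intro borel_measurable_continuous_onI linear_continuous_on matrix_vector_mul_bounded_linear)

lemma orthogonal_matrix_inner:
  fixes R :: "real^'n^'n"
  assumes "orthogonal_matrix R"
  shows "(R *v x) \<bullet> (R *v y) = x \<bullet> y"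
  using assms orthogonal_transformation_matrix[of "(*v) R"]
  by (simp add: orthogonal_transformation_def matrix_vector_mul_linear)

lemma nn_integral_std_normal_density: "(\<integral>\<^sup>+x. ennreal (std_normal_density x) \<partial>lborel) = 1"
  using prob_space.emeasure_space_1[OF prob_space_normal_density[of 1 0]]
  by (simp add: emeasure_density)

lemma prod_std_normal_nn_integral:
  "(\<integral>\<^sup>+x. ennreal (\<Prod>i\<in>UNIV. std_normal_density (x $ i)) \<partial>(lborel :: (real^'n) measure)) = 1"
proof -
  show ?thesis
    using nn_integral_lborel_vec_prod[of "\<lambda>(_::'n) x. ennreal (std_normal_density x)"]
    by (subst prod_ennreal[symmetric]) (auto simp: nn_integral_std_normal_density)
qed

text \<open>The Lebesgue integral is compared with its rotated copy by testing both against the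
  Gaussian density \<open>g\<close>, which is rotation invariant: translation and reflection invariance
  turn \<open>\<integral>\<integral> f (R x) g y\<close> into \<open>\<integral>\<integral> f (R x - y) g (R x) = \<integral>\<integral> f y g x\<close>.\<close>

lemma nn_integral_lborel_orthogonal:
  fixes R :: "real^'n^'n" and f :: "real^'n \<Rightarrow> ennreal"
  assumes R: "orthogonal_matrix R" and [measurable]: "f \<in> borel_measurable borel"
  shows "(\<integral>\<^sup>+x. f (R *v x) \<partial>lborel) = (\<integral>\<^sup>+x. f x \<partial>lborel)"
proof -
  define g :: "real^'n \<Rightarrow> ennreal" where "g x = ennreal (\<Prod>i\<in>UNIV. std_normal_density (x $ i))" for x
  have [measurable]: "g \<in> borel_measurable borel"
    unfolding g_def by measurable
  have gR: "g (R *v x) = g x" for x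
    by (simp add: g_def std_normal_density_prod orthogonal_matrix_inner[OF R])
  have g1: "(\<integral>\<^sup>+x. g x \<partial>lborel) = 1"
    unfolding g_def by (rule prod_std_normal_nn_integral)
  define Q where "Q = transpose R"
  have RR: "R *v (Q *v y) = y" for y
    using R unfolding Q_def orthogonal_matrix_def
    by (metis matrix_vector_mul_assoc matrix_vector_mul_lid)
  have "(\<integral>\<^sup>+x. f (R *v x) \<partial>lborel) = (\<integral>\<^sup>+x. f (R *v x) * (\<integral>\<^sup>+y. g (R *v x + y) \<partial>lborel) \<partial>lborel)"
    by (simp add: nn_integral_lborel_translate g1)
  also have "\<dots> = (\<integral>\<^sup>+x. (\<integral>\<^sup>+y. f (R *v x) * g (R *v x + y) \<partial>lborel) \<partial>lborel)"
    by (simp add: nn_integral_cmult)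
  also have "\<dots> = (\<integral>\<^sup>+y. (\<integral>\<^sup>+x. f (R *v x) * g (R *v x + y) \<partial>lborel) \<partial>lborel)"
    by (rule lborel_pair.Fubini') measurable
  also have "\<dots> = (\<integral>\<^sup>+y. (\<integral>\<^sup>+x. f (R *v x - y) * g x \<partial>lborel) \<partial>lborel)"
  proof (rule nn_integral_cong)
    \<comment> \<open>Shifting \<open>x\<close> by \<open>- (Q *v y)\<close> shifts
      \<open>R *v x\<close> by \<open>- y\<close>, since \<open>Q\<close> is the inverse of
      \<open>R\<close>; this leaves \<open>g (R *v x)\<close>, which is \<open>g x\<close>.\<close>
    fix y :: "real^'n"
    have "(\<integral>\<^sup>+x. f (R *v (- (Q *v y) + x)) * g (R *v (- (Q *v y) + x) + y) \<partial>lborel)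
        = (\<integral>\<^sup>+x. f (R *v x) * g (R *v x + y) \<partial>lborel)"
      by (rule nn_integral_lborel_translate[where f = "\<lambda>x. f (R *v x) * g (R *v x + y)"]) measurable
    then show "(\<integral>\<^sup>+x. f (R *v x) * g (R *v x + y) \<partial>lborel) = (\<integral>\<^sup>+x. f (R *v x - y) * g x \<partial>lborel)"
      by (simp add: matrix_vector_right_distrib matrix_vector_mult_diff_distrib RR gR)
  qed
  also have "\<dots> = (\<integral>\<^sup>+x. (\<integral>\<^sup>+y. f (R *v x - y) * g x \<partial>lborel) \<partial>lborel)"
    by (rule lborel_pair.Fubini') measurable
  also have "\<dots> = (\<integral>\<^sup>+x. f x \<partial>lborel)"
    by (simp add: nn_integral_multc nn_integral_lborel_reflect nn_integral_cmult g1)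
  finally show ?thesis .
qed

lemma std_gaussian_orthogonal:
  fixes R :: "real^'n^'n" and f :: "real^'n \<Rightarrow> ennreal"
  assumes R: "orthogonal_matrix R" and [measurable]: "f \<in> borel_measurable borel"
  shows "(\<integral>\<^sup>+x. f (R *v x) \<partial>std_gaussian) = (\<integral>\<^sup>+x. f x \<partial>std_gaussian)"
proof -
  have "(\<integral>\<^sup>+x. f (R *v x) \<partial>std_gaussian) =
      (\<integral>\<^sup>+x. ennreal (\<Prod>i\<in>UNIV. std_normal_density ((R *v x) $ i)) * f (R *v x) \<partial>lborel)"
    unfolding std_gaussian_def
    by (subst nn_integral_density) (simp_all add: std_normal_density_prod orthogonal_matrix_inner[OF R])
  also have "\<dots> = (\<integral>\<^sup>+x. ennreal (\<Prod>i\<in>UNIV. std_normal_density (x $ i)) * f x \<partial>lborel)"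
    by (rule nn_integral_lborel_orthogonal[OF R]) measurable
  also have "\<dots> = (\<integral>\<^sup>+x. f x \<partial>std_gaussian)"
    unfolding std_gaussian_def by (subst nn_integral_density) simp_all
  finally show ?thesis .
qed

lemma space_std_gaussian [simp]: "space (std_gaussian :: (real^'n) measure) = UNIV"
  and sets_std_gaussian [simp, measurable_cong]: "sets (std_gaussian :: (real^'n) measure) = sets borel"
  by (simp_all add: std_gaussian_def)

lemma prob_space_std_gaussian: "prob_space (std_gaussian :: (real^'n) measure)"
proof
  show "emeasure std_gaussian (space (std_gaussian :: (real^'n) measure)) = 1"
    using prod_std_normal_nn_integral[where 'n='n] by (simp add: std_gaussian_def emeasure_density)
qed

lemma distr_std_gaussian_nth:
  "distr (std_gaussian :: (real^'n) measure) borel (\<lambda>x. x $ i) = density lborel std_normal_density"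
proof (rule measure_eqI)
  fix A assume "A \<in> sets (distr (std_gaussian :: (real^'n) measure) borel (\<lambda>x. x $ i))"
  then have [measurable]: "A \<in> sets borel" by simp
  \<comment> \<open>The indicator is put into factor \<open>i\<close> alone; all other factors
    integrate to 1.\<close>
  let ?f = "\<lambda>j x. ennreal (std_normal_density x) * (if j = i then indicator A x else 1)"
  have "emeasure (distr (std_gaussian :: (real^'n) measure) borel (\<lambda>x. x $ i)) A =
      (\<integral>\<^sup>+x. indicator A (x $ i) \<partial>(std_gaussian :: (real^'n) measure))"
    by (subst nn_integral_indicator[symmetric], simp, subst nn_integral_distr) auto
  also have "\<dots> = (\<integral>\<^sup>+x. (\<Prod>j\<in>UNIV. ?f j (x $ j)) \<partial>(lborel :: (real^'n) measure))"
    unfolding std_gaussian_def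
    by (subst nn_integral_density) (auto simp: prod.distrib prod_ennreal prod.delta)
  also have "\<dots> = (\<Prod>j\<in>UNIV. \<integral>\<^sup>+x. ?f j x \<partial>lborel)"
    by (rule nn_integral_lborel_vec_prod) auto
  also have "\<dots> = (\<Prod>j\<in>UNIV. if j = i then \<integral>\<^sup>+x. ennreal (std_normal_density x) * indicator A x \<partial>lborel else 1)"
    by (rule prod.cong) (auto simp: nn_integral_std_normal_density)
  also have "\<dots> = emeasure (density lborel std_normal_density) A"
    by (simp add: prod.delta emeasure_density)
  finally show "emeasure (distr (std_gaussian :: (real^'n) measure) borel (\<lambda>x. x $ i)) A =
      emeasure (density lborel std_normal_density) A" .
qed simp

section \<open>Logistic mixtures and Gaussianization steps\<close>

lemma Phi_eq_cdf: "Phi = cdf std_normal_distribution"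
  by (rule ext) (simp add: Phi_def cdf_def)

lemma std_normal_real_distribution: "real_distribution std_normal_distribution"
  by (rule real_dist_normal_dist)

lemma std_normal_singleton: "measure std_normal_distribution {x} = 0"
  by (simp add: measure_def emeasure_density nn_integral_null_set)

text \<open>The normal density is positive everywhere, so a nondegenerate interval cannot be a null
  set. Injectivity of \<open>Phi\<close> is what makes the definite description in
  \<open>Phi_inv\<close> meaningful.\<close>

lemma Phi_strict_mono:
  assumes "a < b"
  shows "Phi a < Phi b"
proof -
  interpret real_distribution std_normal_distribution
    by (rule std_normal_real_distribution)
  have "Phi b - Phi a = measure std_normal_distribution {a<..b}"
    using cdf_diff_eq[OF assms] by (simp add: Phi_eq_cdf)
  moreover have "measure std_normal_distribution {a<..b} \<noteq> 0"
  proof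
    assume "measure std_normal_distribution {a<..b} = 0"
    then have "(\<integral>\<^sup>+x. ennreal (std_normal_density x) * indicator {a<..b} x \<partial>lborel) = 0"
      by (simp add: emeasure_eq_measure emeasure_density[symmetric])
    then have "AE x in lborel. ennreal (std_normal_density x) * indicator {a<..b} x = 0"
      by (subst (asm) nn_integral_0_iff_AE) auto
    then have "AE x in lborel. x \<notin> {a<..b}"
    proof eventually_elim
      case (elim x)
      then show ?case
        using normal_density_pos[of 1 0 x] by (auto simp: indicator_def ennreal_eq_0_iff split: if_splits)
    qed
    then have "emeasure lborel {a<..b} = 0"
      by (subst (asm) AE_iff_measurable[where N="{a<..b}"]) auto
    with assms show False by simp
  qed
  ultimately show ?thesis
    using measure_nonneg[of std_normal_distribution "{a<..b}"] by linarith
qed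

lemma Phi_less_iff [simp]: "Phi a < Phi b \<longleftrightarrow> a < b"
  using Phi_strict_mono[of a b] Phi_strict_mono[of b a] by (cases a b rule: linorder_cases) auto

lemma Phi_le_iff [simp]: "Phi a \<le> Phi b \<longleftrightarrow> a \<le> b"
  by (simp add: linorder_not_less[symmetric])

lemma Phi_eq_iff [simp]: "Phi a = Phi b \<longleftrightarrow> a = b"
  by (simp add: order_eq_iff)

lemma isCont_Phi: "isCont Phi x"
proof -
  interpret real_distribution std_normal_distribution
    by (rule std_normal_real_distribution)
  show ?thesis
    unfolding Phi_eq_cdf isCont_cdf by (rule std_normal_singleton)
qed

lemma Phi_at_top: "(Phi \<longlongrightarrow> 1) at_top" and Phi_at_bot: "(Phi \<longlongrightarrow> 0) at_bot"
proof -
  interpret real_distribution std_normal_distribution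
    by (rule std_normal_real_distribution)
  show "(Phi \<longlongrightarrow> 1) at_top" "(Phi \<longlongrightarrow> 0) at_bot"
    unfolding Phi_eq_cdf by (rule cdf_lim_at_top_prob cdf_lim_at_bot)+
qed

lemma Phi_pos: "0 < Phi x" and Phi_less_1: "Phi x < 1"
proof -
  interpret real_distribution std_normal_distribution
    by (rule std_normal_real_distribution)
  have "0 \<le> Phi (x - 1)" "Phi (x + 1) \<le> 1"
    by (auto simp: Phi_def)
  moreover have "Phi (x - 1) < Phi x" "Phi x < Phi (x + 1)"
    by simp_all
  ultimately show "0 < Phi x" "Phi x < 1" by linarith+
qed

text \<open>Applied both to \<open>Phi\<close> and to the mixture distribution functions, to show
  that they attain every value in the open unit interval.\<close>

lemma IVT_limits:
  fixes F :: "real \<Rightarrow> real"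
  assumes "\<And>x. isCont F x" "(F \<longlongrightarrow> l) at_bot" "(F \<longlongrightarrow> u) at_top" "l < y" "y < u"
  obtains x where "F x = y"
proof -
  have "eventually (\<lambda>x. F x < y) at_bot" "eventually (\<lambda>x. y < F x) at_top"
    using assms by (auto intro: order_tendstoD)
  then obtain a b where a: "\<And>x. x \<le> a \<Longrightarrow> F x < y" and b: "\<And>x. b \<le> x \<Longrightarrow> y < F x"
    unfolding eventually_at_bot_linorder eventually_at_top_linorder by auto
  have "\<exists>x\<ge>min a b. x \<le> max a b \<and> F x = y"
    using a[of "min a b"] b[of "max a b"] assms(1) by (intro IVT) auto
  then show ?thesis using that by blast
qed

lemma Phi_inv_Phi [simp]: "Phi_inv (Phi x) = x"
  unfolding Phi_inv_def by (rule the_equality) auto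

lemma Phi_Phi_inv:
  assumes "0 < y" "y < 1"
  shows "Phi (Phi_inv y) = y"
proof -
  obtain x where "Phi x = y"
    by (rule IVT_limits[OF isCont_Phi Phi_at_bot Phi_at_top assms])
  then show ?thesis by auto
qed

lemma isCont_Phi_inv:
  assumes "0 < y" "y < 1"
  shows "isCont Phi_inv y"
proof -
  have "isCont Phi_inv (Phi (Phi_inv y))"
    by (rule isCont_inverse_function[where d=1]) (auto intro: isCont_Phi)
  then show ?thesis
    by (simp add: Phi_Phi_inv assms)
qed

lemma le_Phi_inv_iff:
  assumes "0 < y" "y < 1"
  shows "a \<le> Phi_inv y \<longleftrightarrow> Phi a \<le> y"
  using Phi_le_iff[of a "Phi_inv y"] by (simp add: Phi_Phi_inv[OF assms])

lemma nn_integral_std_normal_atLeast: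
  "(\<integral>\<^sup>+x. ennreal (std_normal_density x) * indicator {a..} x \<partial>lborel) = ennreal (1 - Phi a)"
proof -
  interpret real_distribution std_normal_distribution
    by (rule std_normal_real_distribution)
  have "{a..} = insert a {a<..}" by auto
  then have "measure std_normal_distribution {a..} = measure std_normal_distribution {a<..}"
    using finite_measure_Union[of "{a<..}" "{a}"] by (simp add: std_normal_singleton)
  also have "\<dots> = measure std_normal_distribution (space std_normal_distribution - {..a})"
    by (rule arg_cong[where f="measure _"]) auto
  also have "\<dots> = 1 - Phi a"
    by (subst prob_compl) (auto simp: Phi_def)
  finally have "emeasure std_normal_distribution {a..} = ennreal (1 - Phi a)"
    by (simp add: emeasure_eq_measure)
  then show ?thesis
    by (simp add: emeasure_density)
qed

section \<open>Sigmoids and logistic mixtures\<close>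

lemma sigmoid_pos: "0 < sigmoid t" and sigmoid_less_1: "sigmoid t < 1"
  by (simp_all add: sigmoid_def add_pos_pos)

lemma sigmoid_at_top: "(sigmoid \<longlongrightarrow> 1) at_top" and sigmoid_at_bot: "(sigmoid \<longlongrightarrow> 0) at_bot"
  unfolding sigmoid_def by real_asymp+

text \<open>The derivative of the sigmoid, that is, the density of the standard logistic
  distribution.\<close>

definition logistic_density :: "real \<Rightarrow> real" where
  "logistic_density t = sigmoid t * (1 - sigmoid t)"

lemma logistic_density_pos: "0 < logistic_density t"
  by (simp add: logistic_density_def sigmoid_pos sigmoid_less_1)

lemma sigmoid_deriv: "(sigmoid has_real_derivative logistic_density t) (at t)"
proof -
  have "1 + exp (- t) \<noteq> 0"
    using exp_gt_zero[of "- t"] by linarith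
  then show ?thesis
    unfolding sigmoid_def[abs_def] logistic_density_def sigmoid_def
    by (auto intro!: derivative_eq_intros simp: field_simps power2_eq_square)
qed

text \<open>\<open>F\<close> is the function to which a layer applies \<open>Phi_inv\<close> in one
  coordinate and \<open>f\<close> is its density. Relating the two by one predicate keeps the
  parameters out of all later statements.\<close>

definition logistic_mixture :: "(real \<Rightarrow> real) \<Rightarrow> (real \<Rightarrow> real) \<Rightarrow> bool" where
  "logistic_mixture F f \<longleftrightarrow> (\<exists>(N::nat) (\<mu>::nat \<Rightarrow> real) (s::nat \<Rightarrow> real).
     N \<ge> 1 \<and> (\<forall>j\<in>{1..N}. s j > 0) \<and>
     F = (\<lambda>x. (1 / real N) * (\<Sum>j=1..N. sigmoid ((x - \<mu> j) / s j))) \<and>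
     f = (\<lambda>x. (1 / real N) * (\<Sum>j=1..N. logistic_density ((x - \<mu> j) / s j) / s j)))"

lemma
  assumes "logistic_mixture F f"
  shows logistic_mixture_deriv: "(F has_real_derivative f x) (at x)"
    and logistic_mixture_density_pos: "0 < f x"
    and logistic_mixture_pos: "0 < F x"
    and logistic_mixture_less_1: "F x < 1"
    and logistic_mixture_at_top: "(F \<longlongrightarrow> 1) at_top"
    and logistic_mixture_at_bot: "(F \<longlongrightarrow> 0) at_bot"
    and logistic_mixture_density_continuous: "continuous_on UNIV f"
proof -
  from assms obtain N and \<mu> s :: "nat \<Rightarrow> real" where N: "N \<ge> 1" and s: "\<And>j. j \<in> {1..N} \<Longrightarrow> s j > 0"
    and F: "F = (\<lambda>x. (1 / real N) * (\<Sum>j=1..N. sigmoid ((x - \<mu> j) / s j)))"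
    and f: "f = (\<lambda>x. (1 / real N) * (\<Sum>j=1..N. logistic_density ((x - \<mu> j) / s j) / s j))"
    unfolding logistic_mixture_def by blast
  have ne: "{1..N} \<noteq> {}" using N by auto
  have D: "((\<lambda>x. sigmoid ((x - \<mu> j) / s j)) has_real_derivative
      logistic_density ((x - \<mu> j) / s j) / s j) (at x)" if "j \<in> {1..N}" for j x
  proof -
    have "((\<lambda>x. (x - \<mu> j) / s j) has_real_derivative 1 / s j) (at x)"
      using s[OF that] by (auto intro!: derivative_eq_intros)
    from DERIV_chain2[OF sigmoid_deriv this] show ?thesis by simp
  qed
  show "(F has_real_derivative f x) (at x)"
    unfolding F f by (intro DERIV_cmult DERIV_sum D)
  show "0 < f x"
    unfolding f using N s ne by (intro mult_pos_pos sum_pos divide_pos_pos logistic_density_pos) auto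
  show "0 < F x"
    unfolding F using N ne by (intro mult_pos_pos sum_pos sigmoid_pos) auto
  have "(\<Sum>j=1..N. sigmoid ((x - \<mu> j) / s j)) < (\<Sum>j=1..N. 1)"
    using ne by (intro sum_strict_mono sigmoid_less_1) auto
  then show "F x < 1"
    using N by (simp add: F field_simps)
  have "((\<lambda>x. sigmoid ((x - \<mu> j) / s j)) \<longlongrightarrow> 1) at_top" if "j \<in> {1..N}" for j
    by (rule filterlim_compose[OF sigmoid_at_top]) (use s[OF that] in real_asymp)
  then have "(F \<longlongrightarrow> (1 / real N) * (\<Sum>j=1..N. 1)) at_top"
    unfolding F by (intro tendsto_intros) auto
  then show "(F \<longlongrightarrow> 1) at_top" using N by simp
  have "((\<lambda>x. sigmoid ((x - \<mu> j) / s j)) \<longlongrightarrow> 0) at_bot" if "j \<in> {1..N}" for j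
    by (rule filterlim_compose[OF sigmoid_at_bot]) (use s[OF that] in real_asymp)
  then have "(F \<longlongrightarrow> (1 / real N) * (\<Sum>j=1..N. 0)) at_bot"
    unfolding F by (intro tendsto_intros) auto
  then show "(F \<longlongrightarrow> 0) at_bot" by simp
  have "continuous_on UNIV sigmoid"
    by (intro continuous_at_imp_continuous_on ballI DERIV_isCont[OF sigmoid_deriv])
  then have k: "continuous_on UNIV logistic_density"
    unfolding logistic_density_def by (intro continuous_intros)
  have "continuous_on UNIV (\<lambda>x. logistic_density ((x - \<mu> j) / s j) / s j)" if "j \<in> {1..N}" for j
  proof -
    have "continuous_on UNIV (\<lambda>x. (x - \<mu> j) / s j)"
      using s[OF that] by (intro continuous_intros) auto
    from continuous_on_compose2[OF k this subset_UNIV] show ?thesis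
      using s[OF that] by (intro continuous_on_divide continuous_on_const) auto
  qed
  then show "continuous_on UNIV f"
    unfolding f by (intro continuous_on_mult continuous_on_sum continuous_on_const)
qed

lemma logistic_mixture_strict_mono:
  assumes "logistic_mixture F f" "x < y"
  shows "F x < F y"
  using logistic_mixture_deriv[OF assms(1)] logistic_mixture_density_pos[OF assms(1)]
  by (intro DERIV_pos_imp_increasing[OF assms(2)]) blast

lemma logistic_mixture_le_iff:
  assumes "logistic_mixture F f"
  shows "F x \<le> F y \<longleftrightarrow> x \<le> y"
  using logistic_mixture_strict_mono[OF assms, of x y] logistic_mixture_strict_mono[OF assms, of y x]
  by (cases x y rule: linorder_cases) auto

lemma logistic_mixture_borel [measurable_dest]:
  assumes "logistic_mixture F f"
  shows "f \<in> borel_measurable borel"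
  using logistic_mixture_density_continuous[OF assms] by (rule borel_measurable_continuous_onI)

lemma isCont_Phi_inv_logistic_mixture:
  assumes "logistic_mixture F f"
  shows "isCont (\<lambda>x. Phi_inv (F x)) x"
  by (rule isCont_o2[OF DERIV_isCont[OF logistic_mixture_deriv[OF assms]]])
    (intro isCont_Phi_inv logistic_mixture_pos[OF assms] logistic_mixture_less_1[OF assms])

text \<open>The one-dimensional transport to the normal law, tested on half-lines. If
  \<open>F c = Phi a\<close>, the preimage of \<open>{a..}\<close> is \<open>{c..}\<close>, whose
  mass \<open>1 - F c\<close> equals \<open>1 - Phi a\<close>.\<close>

lemma Phi_inv_logistic_mixture_atLeast:
  assumes mix: "logistic_mixture F f"
  shows "(\<integral>\<^sup>+x. ennreal (f x) * indicator {a..} (Phi_inv (F x)) \<partial>lborel) =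
    (\<integral>\<^sup>+x. ennreal (std_normal_density x) * indicator {a..} x \<partial>lborel)"
proof -
  obtain c where c: "F c = Phi a"
    by (rule IVT_limits[OF DERIV_isCont[OF logistic_mixture_deriv[OF mix]]
          logistic_mixture_at_bot[OF mix] logistic_mixture_at_top[OF mix] Phi_pos[of a] Phi_less_1])
  have "indicator {a..} (Phi_inv (F x)) = (indicator {c..} x :: ennreal)" for x
    using logistic_mixture_le_iff[OF mix, of c x] logistic_mixture_pos[OF mix, of x] logistic_mixture_less_1[OF mix, of x]
    by (simp add: indicator_def le_Phi_inv_iff c)
  moreover have "(\<integral>\<^sup>+x. ennreal (f x) * indicator {c..} x \<partial>lborel) = ennreal (1 - F c)"
    using mix
    by (intro nn_integral_FTC_atLeast logistic_mixture_deriv logistic_mixture_at_top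
        logistic_mixture_borel less_imp_le[OF logistic_mixture_density_pos])
  ultimately show ?thesis
    by (simp add: nn_integral_std_normal_atLeast c)
qed

text \<open>A half-space bounding coordinate \<open>i\<close> from below is the countable union of
  upper orthants whose other corner coordinates run to minus infinity.\<close>

lemma borel_eq_atLeast:
  "borel = sigma UNIV (range (\<lambda>a. {a::'a::ordered_euclidean_space..}))"
  (is "_ = ?SIGMA")
proof (rule borel_eq_sigmaI4[OF borel_eq_halfspace_ge])
  fix a :: real and i :: 'a assume "(a, i) \<in> UNIV \<times> Basis"
  then have i: "i \<in> Basis" by auto
  have "\<exists>k::nat. \<forall>j\<in>Basis. j \<noteq> i \<longrightarrow> - real k \<le> x \<bullet> j" for x :: 'a
  proof -
    obtain k :: nat where "norm x \<le> real k"
      using real_arch_simple by blast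
    then have "- real k \<le> x \<bullet> j" if "j \<in> Basis" for j
      using Basis_le_norm[OF that, of x] by linarith
    then show ?thesis by blast
  qed
  with i have *: "{x::'a. a \<le> x \<bullet> i} = (\<Union>k::nat. {(\<Sum>n\<in>Basis. (if n = i then a else - real k) *\<^sub>R n)..})"
    by (force simp: eucl_le[where 'a='a] split: if_split_asm)
  show "{x. a \<le> x \<bullet> i} \<in> ?SIGMA" unfolding *
    by (intro sets.countable_UN) auto
qed auto

text \<open>Upper orthants are closed under intersection, the corners being joined by
  \<open>sup\<close>, and countably many of them exhaust the space, so they determine a finite
  measure.\<close>

lemma measure_eqI_atLeast:
  fixes M N :: "'a::ordered_euclidean_space measure"
  assumes "sets M = sets borel" "sets N = sets borel" "finite_measure M"
    and eq: "\<And>a. emeasure M {a..} = emeasure N {a..}"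
  shows "M = N"
proof (rule measure_eqI_generator_eq[where \<Omega>=UNIV and E="range atLeast"
      and A="\<lambda>k::nat. {- (real k *\<^sub>R One)..}"])
  show "Int_stable (range (atLeast :: 'a \<Rightarrow> 'a set))"
  proof (rule Int_stableI_image)
    fix a b :: 'a
    show "\<exists>c\<in>UNIV. {a..} \<inter> {b..} = {c..}"
      by (intro bexI[of _ "sup a b"]) (auto intro: le_supI1 le_supI2)
  qed
  have B: "sets (borel :: 'a measure) = sigma_sets UNIV (range atLeast)"
    by (subst borel_eq_atLeast) simp
  then show "sets M = sigma_sets UNIV (range atLeast)" "sets N = sigma_sets UNIV (range atLeast)"
    using assms by simp_all
  show "(\<Union>k::nat. {- (real k *\<^sub>R One)..}) = (UNIV :: 'a set)"
  proof (intro set_eqI iffI UNIV_I)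
    fix x :: 'a
    obtain k :: nat where k: "norm x \<le> real k"
      using real_arch_simple by blast
    have "- real k \<le> x \<bullet> i" if "i \<in> Basis" for i
      using Basis_le_norm[OF that, of x] k by linarith
    then have "- (real k *\<^sub>R One) \<le> x"
      by (simp add: eucl_le[where 'a='a])
    then show "x \<in> (\<Union>k::nat. {- (real k *\<^sub>R One)..})" by blast
  qed
  show "emeasure M {- (real k *\<^sub>R One)..} \<noteq> \<infinity>" for k :: nat
    using finite_measure.emeasure_finite[OF assms(3)] by simp
qed (use eq in auto)

text \<open>Upper orthants are products of half-lines and the map acts coordinatewise, so both
  measures of an orthant factor and the one-dimensional transport applies to each factor.\<close>

lemma distr_product_logistic_mixture:
  fixes F f :: "'n::finite \<Rightarrow> real \<Rightarrow> real"
  assumes mix: "\<And>i. logistic_mixture (F i) (f i)"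
  shows "distr (density lborel (\<lambda>x::real^'n. \<Prod>i\<in>UNIV. f i (x $ i))) borel
      (\<lambda>x. \<chi> i. Phi_inv (F i (x $ i))) = std_gaussian"
proof -
  define \<Psi> where "\<Psi> = (\<lambda>x::real^'n. \<chi> i. Phi_inv (F i (x $ i)))"
  have [measurable]: "f i \<in> borel_measurable borel" for i
    by (rule logistic_mixture_borel[OF mix])
  have Pm: "(\<lambda>x. Phi_inv (F i x)) \<in> borel_measurable borel" for i
    by (intro borel_measurable_continuous_onI continuous_at_imp_continuous_on ballI
        isCont_Phi_inv_logistic_mixture[OF mix])
  have [measurable]: "\<Psi> \<in> borel_measurable borel"
    unfolding \<Psi>_def
    by (intro borel_measurable_continuous_onI continuous_on_vec_lambda continuous_at_imp_continuous_on ballI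
        isCont_o2[OF _ isCont_Phi_inv_logistic_mixture[OF mix]]) (intro continuous_intros)
  define M where "M = density lborel (\<lambda>x::real^'n. ennreal (\<Prod>i\<in>UNIV. f i (x $ i)))"
  have setsM [measurable_cong]: "sets M = sets borel" by (simp add: M_def)
  have f0: "0 \<le> f i x" for i x
    by (rule less_imp_le[OF logistic_mixture_density_pos[OF mix]])
  have nnM: "(\<integral>\<^sup>+x. (\<Prod>i\<in>UNIV. g i (x $ i)) \<partial>M) = (\<Prod>i\<in>UNIV. \<integral>\<^sup>+x. ennreal (f i x) * g i x \<partial>lborel)"
    if [measurable]: "\<And>i. g i \<in> borel_measurable borel" for g
  proof -
    have "(\<integral>\<^sup>+x. (\<Prod>i\<in>UNIV. g i (x $ i)) \<partial>M) =
        (\<integral>\<^sup>+x. (\<Prod>i\<in>UNIV. ennreal (f i (x $ i)) * g i (x $ i)) \<partial>lborel)"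
      unfolding M_def by (subst nn_integral_density) (auto simp: prod.distrib prod_ennreal f0)
    also have "\<dots> = (\<Prod>i\<in>UNIV. \<integral>\<^sup>+x. ennreal (f i x) * g i x \<partial>lborel)"
      by (rule nn_integral_lborel_vec_prod) measurable
    finally show ?thesis .
  qed
  have "std_gaussian = distr M borel \<Psi>"
  proof (rule measure_eqI_atLeast)
    show "finite_measure (std_gaussian :: (real^'n) measure)"
      by (rule prob_space.finite_measure[OF prob_space_std_gaussian])
    fix a :: "real^'n"
    have ind: "indicator {a..} y = (\<Prod>i\<in>UNIV. indicator {a $ i..} (y $ i) :: ennreal)" for y
      by (auto simp: indicator_def less_eq_vec_def prod_zero_iff intro!: prod.neutral[symmetric])
    have "emeasure (distr M borel \<Psi>) {a..} = (\<integral>\<^sup>+x. indicator {a..} (\<Psi> x) \<partial>M)"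
      by (subst nn_integral_indicator[symmetric], simp, subst nn_integral_distr) auto
    also have "\<dots> = (\<Prod>i\<in>UNIV. \<integral>\<^sup>+x. ennreal (f i x) * indicator {a $ i..} (Phi_inv (F i x)) \<partial>lborel)"
      unfolding ind \<Psi>_def vec_lambda_beta
      by (rule nnM) (use Pm in measurable)
    also have "\<dots> = (\<Prod>i\<in>UNIV. \<integral>\<^sup>+x. ennreal (std_normal_density x) * indicator {a $ i..} x \<partial>lborel)"
      by (simp add: Phi_inv_logistic_mixture_atLeast[OF mix])
    also have "\<dots> = (\<integral>\<^sup>+x. (\<Prod>i\<in>UNIV. ennreal (std_normal_density (x $ i)) * indicator {a $ i..} (x $ i)) \<partial>lborel)"
      by (rule nn_integral_lborel_vec_prod[symmetric]) measurable
    also have "\<dots> = emeasure std_gaussian {a..}"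
      unfolding std_gaussian_def
      by (subst emeasure_density) (auto simp: ind prod.distrib prod_ennreal)
    finally show "emeasure std_gaussian {a..} = emeasure (distr M borel \<Psi>) {a..}" ..
  qed simp_all
  then show ?thesis
    unfolding M_def \<Psi>_def ..
qed

text \<open>The exponent \<open>G\<close> is carried as an argument so that the gain of a step under
  a law can be written as the expectation of \<open>G\<close>.\<close>

definition gaussianization_step :: "(real^'n \<Rightarrow> real^'n) \<Rightarrow> real^'n^'n \<Rightarrow> (real^'n \<Rightarrow> real) \<Rightarrow> bool" where
  "gaussianization_step \<Psi> R G \<longleftrightarrow> orthogonal_matrix R \<and>
     (\<exists>F f. (\<forall>i. logistic_mixture (F i) (f i)) \<and>
        \<Psi> = (\<lambda>x. \<chi> i. Phi_inv (F i (x $ i))) \<and>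
        G = (\<lambda>x. \<Sum>i\<in>UNIV. ln (f i ((R *v x) $ i) / std_normal_density ((R *v x) $ i))))"

lemma gaussianization_stepE:
  assumes "gaussianization_step \<Psi> R G"
  obtains F f where "orthogonal_matrix R" "\<forall>i. logistic_mixture (F i) (f i)"
    "\<Psi> = (\<lambda>x. \<chi> i. Phi_inv (F i (x $ i)))"
    "G = (\<lambda>x. \<Sum>i\<in>UNIV. ln (f i ((R *v x) $ i) / std_normal_density ((R *v x) $ i)))"
proof -
  from assms have "orthogonal_matrix R"
    unfolding gaussianization_step_def by (rule conjunct1)
  moreover from assms have "\<exists>F f. (\<forall>i. logistic_mixture (F i) (f i)) \<and>
        \<Psi> = (\<lambda>x. \<chi> i. Phi_inv (F i (x $ i))) \<and>
        G = (\<lambda>x. \<Sum>i\<in>UNIV. ln (f i ((R *v x) $ i) / std_normal_density ((R *v x) $ i)))"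
    unfolding gaussianization_step_def by (rule conjunct2)
  ultimately show ?thesis
    by (elim exE conjE) (rule that)
qed

lemma gaussianization_step_layer:
  assumes "gaussianization_step \<Psi> R G"
  shows "marginal_gaussianization_layer \<Psi>"
proof -
  from assms obtain F f where m: "\<forall>i. logistic_mixture (F i) (f i)"
    and \<Psi>: "\<Psi> = (\<lambda>x. \<chi> i. Phi_inv (F i (x $ i)))"
    by (rule gaussianization_stepE)
  note mix = m[rule_format]
  show ?thesis
    unfolding marginal_gaussianization_layer_def
  proof
    fix i
    from mix[of i] obtain N and \<mu> s :: "nat \<Rightarrow> real" where "N \<ge> 1" "\<forall>j\<in>{1..N}. s j > 0"
      "F i = (\<lambda>x. (1 / real N) * (\<Sum>j=1..N. sigmoid ((x - \<mu> j) / s j)))"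
      unfolding logistic_mixture_def by blast
    then show "\<exists>N \<mu> s. 1 \<le> N \<and> (\<forall>j\<in>{1..N}. 0 < s j) \<and>
        (\<forall>x. \<Psi> x $ i = Phi_inv (1 / real N * (\<Sum>j = 1..N. sigmoid ((x $ i - \<mu> j) / s j))))"
      by (intro exI[of _ N] exI[of _ \<mu>] exI[of _ s]) (simp add: \<Psi>)
  qed
qed

lemma gaussianization_step_continuous:
  assumes "gaussianization_step \<Psi> R G"
  shows "continuous_on UNIV (\<lambda>x. \<Psi> (R *v x))" and "continuous_on UNIV G"
proof -
  from assms obtain F f where m: "\<forall>i. logistic_mixture (F i) (f i)"
    and \<Psi>: "\<Psi> = (\<lambda>x. \<chi> i. Phi_inv (F i (x $ i)))"
    and G: "G = (\<lambda>x. \<Sum>i\<in>UNIV. ln (f i ((R *v x) $ i) / std_normal_density ((R *v x) $ i)))"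
    by (rule gaussianization_stepE)
  note mix = m[rule_format]
  have R: "continuous_on UNIV (\<lambda>x. (R *v x) $ i)" for i
    by (intro continuous_on_component linear_continuous_on matrix_vector_mul_bounded_linear)
  have "continuous_on UNIV (\<lambda>x. Phi_inv (F i x))" for i
    by (intro continuous_at_imp_continuous_on ballI isCont_Phi_inv_logistic_mixture[OF mix])
  then show "continuous_on UNIV (\<lambda>x. \<Psi> (R *v x))"
    unfolding \<Psi> by (intro continuous_on_vec_lambda continuous_on_compose2[OF _ R subset_UNIV])
  have "continuous_on UNIV (\<lambda>x. ln (f i x / std_normal_density x))" for i
    using logistic_mixture_density_continuous[OF mix[of i]] logistic_mixture_density_pos[OF mix[of i]]
    unfolding std_normal_density_def by (intro continuous_intros) (auto simp: less_imp_neq[symmetric])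
  then show "continuous_on UNIV G"
    unfolding G
    by (intro continuous_on_sum continuous_on_compose2[where g="\<lambda>x. ln (f _ x / std_normal_density x)", OF _ R subset_UNIV])
qed

text \<open>Change of variables for one step: \<open>exp G\<close> is the density, with respect to the Gaussian,
  of the pullback of the Gaussian along the step.\<close>

lemma gaussianization_step_nn_integral:
  fixes H :: "real^'n \<Rightarrow> ennreal"
  assumes step: "gaussianization_step \<Psi> R G" and [measurable]: "H \<in> borel_measurable borel"
  shows "(\<integral>\<^sup>+x. ennreal (exp (G x)) * H (\<Psi> (R *v x)) \<partial>std_gaussian) = (\<integral>\<^sup>+x. H x \<partial>std_gaussian)"
proof -
  from step obtain F f where R: "orthogonal_matrix R" and m: "\<forall>i. logistic_mixture (F i) (f i)"
    and \<Psi>: "\<Psi> = (\<lambda>x. \<chi> i. Phi_inv (F i (x $ i)))"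
    and G: "G = (\<lambda>x. \<Sum>i\<in>UNIV. ln (f i ((R *v x) $ i) / std_normal_density ((R *v x) $ i)))"
    by (rule gaussianization_stepE)
  note mix = m[rule_format]
  have [measurable]: "f i \<in> borel_measurable borel" for i
    by (rule logistic_mixture_borel[OF mix])
  have [measurable]: "\<Psi> \<in> borel_measurable borel"
    unfolding \<Psi>
    by (intro borel_measurable_continuous_onI continuous_on_vec_lambda continuous_at_imp_continuous_on ballI
        isCont_o2[OF _ isCont_Phi_inv_logistic_mixture[OF mix]]) (intro continuous_intros)
  \<comment> \<open>\<open>exp G\<close> is \<open>u\<close> at the rotated point, so rotation
    invariance removes \<open>R\<close>; multiplying \<open>u\<close> by the Gaussian density then
    leaves the product of the mixture densities.\<close>
  define u where "u z = (\<Prod>i\<in>UNIV. f i (z $ i) / std_normal_density (z $ i))" for z :: "real^'n"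
  have [measurable]: "u \<in> borel_measurable borel"
    unfolding u_def by measurable
  have f0: "0 < f i x" for i x
    by (rule logistic_mixture_density_pos[OF mix])
  have "exp (G x) = u (R *v x)" for x
    by (simp add: G u_def exp_sum f0 normal_density_pos)
  then have "(\<integral>\<^sup>+x. ennreal (exp (G x)) * H (\<Psi> (R *v x)) \<partial>std_gaussian) =
      (\<integral>\<^sup>+x. ennreal (u (R *v x)) * H (\<Psi> (R *v x)) \<partial>std_gaussian)"
    by simp
  also have "\<dots> = (\<integral>\<^sup>+z. ennreal (u z) * H (\<Psi> z) \<partial>std_gaussian)"
    by (rule std_gaussian_orthogonal[OF R, where f="\<lambda>z. ennreal (u z) * H (\<Psi> z)"]) measurable
  also have "\<dots> = (\<integral>\<^sup>+z. ennreal (\<Prod>i\<in>UNIV. std_normal_density (z $ i)) * (ennreal (u z) * H (\<Psi> z)) \<partial>lborel)"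
    unfolding std_gaussian_def by (rule nn_integral_density) measurable
  also have "\<dots> = (\<integral>\<^sup>+z. ennreal (\<Prod>i\<in>UNIV. f i (z $ i)) * H (\<Psi> z) \<partial>lborel)"
  proof (rule nn_integral_cong)
    fix z :: "real^'n"
    have "(\<Prod>i\<in>UNIV. std_normal_density (z $ i)) * u z = (\<Prod>i\<in>UNIV. f i (z $ i))"
      unfolding u_def prod.distrib[symmetric]
      by (rule prod.cong) (simp_all add: normal_density_pos less_imp_neq[symmetric])
    moreover have "0 \<le> u z"
      unfolding u_def by (intro prod_nonneg divide_nonneg_pos less_imp_le[OF f0] normal_density_pos) auto
    ultimately show "ennreal (\<Prod>i\<in>UNIV. std_normal_density (z $ i)) * (ennreal (u z) * H (\<Psi> z)) =
      ennreal (\<Prod>i\<in>UNIV. f i (z $ i)) * H (\<Psi> z)"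
      by (simp add: mult.assoc[symmetric] ennreal_mult[symmetric] prod_nonneg)
  qed
  also have "\<dots> = (\<integral>\<^sup>+z. H (\<Psi> z) \<partial>density lborel (\<lambda>z. ennreal (\<Prod>i\<in>UNIV. f i (z $ i))))"
    by (subst nn_integral_density) auto
  also have "\<dots> = (\<integral>\<^sup>+y. H y \<partial>distr (density lborel (\<lambda>z. ennreal (\<Prod>i\<in>UNIV. f i (z $ i)))) borel \<Psi>)"
    by (rule nn_integral_distr[symmetric]) auto
  also have "distr (density lborel (\<lambda>z. ennreal (\<Prod>i\<in>UNIV. f i (z $ i)))) borel \<Psi> = std_gaussian"
    unfolding \<Psi> by (rule distr_product_logistic_mixture[OF mix])
  finally show ?thesis .
qed

section \<open>Approximation by logistic mixtures\<close>

lemma sigmoid_minus: "sigmoid (- t) = 1 - sigmoid t"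
proof -
  have "1 + exp t \<noteq> 0" "1 + exp (- t) \<noteq> 0"
    using exp_gt_zero[of t] exp_gt_zero[of "- t"] by linarith+
  moreover have "exp t * exp (- t) = 1"
    by (simp add: exp_minus)
  ultimately show ?thesis
    by (simp add: sigmoid_def field_simps)
qed

lemma sigmoid_mono: "a \<le> b \<Longrightarrow> sigmoid a \<le> sigmoid b"
  by (auto simp: sigmoid_def intro!: divide_left_mono add_pos_pos mult_pos_pos)

lemma logistic_density_minus: "logistic_density (- t) = logistic_density t"
  by (simp add: logistic_density_def sigmoid_minus)

text \<open>The kernel is \<open>sigmoid a * sigmoid (- a)\<close>. From \<open>a\<close> up to
  \<open>b\<close> the first factor increases and the second shrinks by at most the factor
  \<open>exp (a - b)\<close>; symmetry of the kernel covers the other direction.\<close>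

lemma logistic_density_Harnack: "logistic_density a \<le> exp \<bar>a - b\<bar> * logistic_density b"
proof -
  have *: "logistic_density a \<le> exp (b - a) * logistic_density b" if "a \<le> b" for a b
  proof -
    have "exp a * (1 + exp b) \<le> exp b * (1 + exp a)"
      using that by (simp add: algebra_simps)
    then have "1 + exp b \<le> exp (b - a) * (1 + exp a)"
      by (simp add: exp_diff field_simps)
    then have "1 / (1 + exp a) \<le> exp (b - a) * (1 / (1 + exp b))"
      by (simp add: field_simps add_pos_pos)
    then have "sigmoid (- a) \<le> exp (b - a) * sigmoid (- b)"
      by (simp add: sigmoid_def)
    then have "sigmoid a * sigmoid (- a) \<le> sigmoid b * (exp (b - a) * sigmoid (- b))"
      by (intro mult_mono sigmoid_mono that less_imp_le[OF sigmoid_pos])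
    then show ?thesis
      by (simp add: logistic_density_def sigmoid_minus mult_ac)
  qed
  show ?thesis
    using *[of a b] *[of "- a" "- b"] by (cases "a \<le> b") (auto simp: logistic_density_minus)
qed

text \<open>The mean value theorem gives the kernel at an intermediate point; the Harnack inequality
  moves that point to the left endpoint.\<close>

lemma sigmoid_increment_le:
  assumes "a \<le> b"
  shows "sigmoid b - sigmoid a \<le> (b - a) * exp (b - a) * logistic_density a"
proof (cases "a = b")
  case False
  with assms have "a < b" by simp
  then obtain z where z: "a < z" "z < b" "sigmoid b - sigmoid a = (b - a) * logistic_density z"
    using MVT2[of a b sigmoid logistic_density] sigmoid_deriv by blast
  have "logistic_density z \<le> exp \<bar>z - a\<bar> * logistic_density a"
    by (rule logistic_density_Harnack)
  also have "\<dots> \<le> exp (b - a) * logistic_density a"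
    using z by (intro mult_right_mono less_imp_le[OF logistic_density_pos]) auto
  finally show ?thesis
    using z(3) assms by (simp add: mult.assoc mult_left_mono)
qed simp

text \<open>A layer weights its sigmoids equally, so integer weights are realised by listing the
  centre \<open>y m\<close> exactly \<open>n m\<close> times. One list \<open>\<mu>\<close> serves
  all \<open>g\<close>, hence both the mixture and its density.\<close>

lemma sum_with_repetitions:
  fixes y :: "nat \<Rightarrow> 'a" and n :: "nat \<Rightarrow> nat"
  shows "\<exists>\<mu> :: nat \<Rightarrow> 'a. \<forall>g :: 'a \<Rightarrow> real. (\<Sum>j=1..(\<Sum>m<P. n m). g (\<mu> j)) = (\<Sum>m<P. real (n m) * g (y m))"
proof (induction P)
  case (Suc P)
  then obtain \<mu> :: "nat \<Rightarrow> 'a" where \<mu>: "\<And>g :: 'a \<Rightarrow> real. (\<Sum>j=1..(\<Sum>m<P. n m). g (\<mu> j)) = (\<Sum>m<P. real (n m) * g (y m))"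
    by blast
  define A where "A = (\<Sum>m<P. n m)"
  define \<mu>' where "\<mu>' j = (if j \<le> A then \<mu> j else y P)" for j
  have "(\<Sum>j=1..(\<Sum>m<Suc P. n m). g (\<mu>' j)) = (\<Sum>m<Suc P. real (n m) * g (y m))" for g :: "'a \<Rightarrow> real"
  proof -
    have "(\<Sum>j=1..A + n P. g (\<mu>' j)) = (\<Sum>j=1..A. g (\<mu>' j)) + (\<Sum>j=A+1..A + n P. g (\<mu>' j))"
      by (rule sum.ub_add_nat) simp
    also have "(\<Sum>j=1..A. g (\<mu>' j)) = (\<Sum>j=1..A. g (\<mu> j))"
      by (rule sum.cong) (auto simp: \<mu>'_def)
    also have "\<dots> = (\<Sum>m<P. real (n m) * g (y m))"
      unfolding A_def by (rule \<mu>)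
    also have "(\<Sum>j=A+1..A + n P. g (\<mu>' j)) = (\<Sum>j=A+1..A + n P. g (y P))"
      by (rule sum.cong) (auto simp: \<mu>'_def)
    finally show ?thesis
      by (simp add: A_def)
  qed
  then show ?case by blast
qed simp

text \<open>Each point of a fine grid is taken as a centre \<open>\<lfloor>N w\<rfloor>\<close> times, \<open>w\<close> being the mass that \<open>f\<close>
  gives to its cell. By the Harnack inequality the kernel at a grid point dominates, up to a
  factor close to \<open>1\<close>, the increment of the sigmoid over the cell, so the sum over the cells
  near \<open>x\<close> telescopes.\<close>

lemma logistic_mixture_approx:
  fixes f :: "real \<Rightarrow> real"
  assumes cont: "continuous_on UNIV f" and pos: "\<And>x. 0 < f x"
    and int: "(\<integral>\<^sup>+x. ennreal (f x) \<partial>lborel) = 1" and \<epsilon>: "0 < \<epsilon>" "\<epsilon> < 1"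
  obtains F g where "logistic_mixture F g" "\<And>x. \<bar>x\<bar> \<le> M \<Longrightarrow> (1 - \<epsilon>) * f x \<le> g x"
proof -
  \<comment> \<open>The losses below multiply to
    \<open>(1 - 2 * \<eta>) * (1 - \<eta>) * (1 - \<eta>)\<close>, which is at least
    \<open>1 - 4 * \<eta>\<close>.\<close>
  define \<eta> where "\<eta> = \<epsilon> / 4"
  have \<eta>: "0 < \<eta>" "\<eta> < 1/4" using \<epsilon> by (auto simp: \<eta>_def)
  \<comment> \<open>The margin 1 exceeds the radius \<open>r\<close> chosen below, so the
    \<open>r\<close>-neighbourhood of any point considered stays inside
    \<open>{-L..L}\<close>.\<close>
  define L where "L = max M 0 + 1"
  have L: "L > 0" "M + 1 \<le> L" by (auto simp: L_def)
  have contK: "continuous_on {-L..L} f" by (rule continuous_on_subset[OF cont]) auto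
  obtain x0 where x0: "\<And>x. x \<in> {-L..L} \<Longrightarrow> f x0 \<le> f x"
    using continuous_attains_inf[OF compact_Icc _ contK] L by fastforce
  \<comment> \<open>As \<open>f x0\<close> is the minimum of \<open>f\<close> on the interval, an
    absolute error \<open>e\<close> is a relative error of at most \<open>\<eta>\<close>.\<close>
  define e where "e = \<eta> * f x0"
  have e: "0 < e" using \<eta> pos by (simp add: e_def)
  obtain d where d: "0 < d" "\<And>x y. x \<in> {-L..L} \<Longrightarrow> y \<in> {-L..L} \<Longrightarrow> dist y x < d \<Longrightarrow> dist (f y) (f x) < e"
    using compact_uniformly_continuous[OF contK compact_Icc] e unfolding uniformly_continuous_on_def by blast
  define r where "r = min (d / 2) (1 / 2)"
  have r: "0 < r" "r < d" "r < 1" using d by (auto simp: r_def)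
  have "eventually (\<lambda>t. 1 - \<eta> / 2 < sigmoid t) at_top"
    using order_tendstoD(1)[OF sigmoid_at_top, of "1 - \<eta> / 2"] \<eta> by simp
  then obtain t0 where t0: "\<And>t. t0 \<le> t \<Longrightarrow> 1 - \<eta> / 2 < sigmoid t"
    unfolding eventually_at_top_linorder by blast
  \<comment> \<open>The scale is so small that the logistic kernel has mass more than
    \<open>1 - \<eta>\<close> within distance \<open>r / 2\<close> of its centre.\<close>
  define s where "s = r / (2 * max t0 1)"
  have s: "0 < s" using r by (simp add: s_def)
  have "r / (2 * s) = max t0 1" using r by (simp add: s_def)
  then have sig: "1 - \<eta> < sigmoid (r / (2 * s)) - sigmoid (- (r / (2 * s)))"
    using t0[of "r / (2 * s)"] by (simp add: sigmoid_minus)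
  \<comment> \<open>A cell width up to \<open>r / 2\<close> puts grid points in both outer halves of
    the \<open>r\<close>-neighbourhood of \<open>x\<close>; one up to \<open>s * \<eta>\<close>
    keeps the Harnack factor \<open>exp (h / s)\<close> below \<open>exp \<eta>\<close>.\<close>
  define h0 where "h0 = min (r / 2) (s * \<eta>)"
  have h0: "0 < h0" using r s \<eta> by (simp add: h0_def)
  define P where "P = nat \<lceil>2 * L / h0\<rceil>"
  have "2 * L / h0 > 0" using L h0 by simp
  then have P: "P > 0" "2 * L / h0 \<le> real P"
    unfolding P_def by linarith+
  define h where "h = 2 * L / real P"
  have h: "0 < h" using L P by (simp add: h_def)
  have "h \<le> h0" using P h0 L by (simp add: h_def field_simps)
  then have hr: "h \<le> r / 2" and hs: "h \<le> s * \<eta>" by (auto simp: h0_def)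
  have Ph: "real P * h = 2 * L" using P by (simp add: h_def)
  define y where "y m = - L + real m * h" for m :: nat
  have y_mono: "y i \<le> y j" if "i \<le> j" for i j
    using that h by (simp add: y_def mult_right_mono)
  have y_Suc: "y (Suc m) = y m + h" for m
    by (simp add: y_def algebra_simps)
  define \<nu> where "\<nu> = density lborel (\<lambda>x. ennreal (f x))"
  have [measurable]: "f \<in> borel_measurable borel"
    by (rule borel_measurable_continuous_onI[OF cont])
  interpret \<nu>: prob_space \<nu>
    by standard (simp add: \<nu>_def emeasure_density int)
  define w where "w m = measure \<nu> {y m..<y (Suc m)}" for m
  have w_sum: "(\<Sum>m<P. w m) \<le> 1"
  proof -
    have "disjoint_family_on (\<lambda>m. {y m..<y (Suc m)}) {..<P}"
      unfolding disjoint_family_on_def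
    proof (intro ballI impI)
      fix i j :: nat assume "i \<noteq> j"
      then consider "Suc i \<le> j" | "Suc j \<le> i" by linarith
      then show "{y i..<y (Suc i)} \<inter> {y j..<y (Suc j)} = {}"
        using y_mono[of "Suc i" j] y_mono[of "Suc j" i] by cases auto
    qed
    then have "measure \<nu> (\<Union>m<P. {y m..<y (Suc m)}) = (\<Sum>m<P. w m)"
      unfolding w_def by (intro \<nu>.finite_measure_finite_Union) (auto simp: \<nu>_def)
    then show ?thesis
      by (metis \<nu>.prob_le_1)
  qed
  have w_ge: "h * c \<le> w m" if c: "0 \<le> c" "\<And>z. z \<in> {y m..<y (Suc m)} \<Longrightarrow> c \<le> f z" for c m
  proof -
    have "ennreal (h * c) = ennreal c * emeasure lborel {y m..<y (Suc m)}"
      using h c by (simp add: y_Suc ennreal_mult mult.commute)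
    also have "\<dots> = (\<integral>\<^sup>+z. ennreal c * indicator {y m..<y (Suc m)} z \<partial>lborel)"
      by (simp add: nn_integral_cmult_indicator)
    also have "\<dots> \<le> (\<integral>\<^sup>+z. ennreal (f z) * indicator {y m..<y (Suc m)} z \<partial>lborel)"
      by (intro nn_integral_mono) (use c in \<open>auto simp: indicator_def intro: ennreal_leI\<close>)
    also have "\<dots> = emeasure \<nu> {y m..<y (Suc m)}"
      by (simp add: \<nu>_def emeasure_density)
    also have "\<dots> = ennreal (w m)"
      by (simp add: w_def \<nu>.emeasure_eq_measure)
    finally show ?thesis
      by (simp add: w_def)
  qed
  \<comment> \<open>Rounding the cell masses down to multiples of \<open>1 / N\<close> then costs at
    most \<open>h * e\<close> per cell, which is an error \<open>e\<close> in the density.\<close>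
  define N where "N = nat \<lceil>1 / (h * e)\<rceil>"
  have "1 / (h * e) > 0" using h e by simp
  then have N: "N \<ge> 1" "1 / (h * e) \<le> real N"
    unfolding N_def by linarith+
  then have Nh: "1 / real N \<le> h * e" using h e by (simp add: field_simps)
  define n where "n m = nat \<lfloor>real N * w m\<rfloor>" for m
  have n_le: "real (n m) \<le> real N * w m" and n_ge: "real N * w m - 1 \<le> real (n m)" for m
    using mult_nonneg_nonneg[of "real N" "w m"] measure_nonneg[of \<nu> "{y m..<y (Suc m)}"]
    unfolding n_def w_def by linarith+
  have "real (\<Sum>m<P. n m) \<le> (\<Sum>m<P. real N * w m)"
    unfolding of_nat_sum by (intro sum_mono n_le)
  also have "\<dots> \<le> real N"
    using w_sum by (simp add: sum_distrib_left[symmetric] mult_left_le)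
  finally have n_sum: "(\<Sum>m<P. n m) \<le> N" by (simp only: of_nat_le_iff)
  obtain \<mu> :: "nat \<Rightarrow> real" where \<mu>: "\<And>g :: real \<Rightarrow> real. (\<Sum>j=1..(\<Sum>m<P. n m). g (\<mu> j)) = (\<Sum>m<P. real (n m) * g (y m))"
    using sum_with_repetitions[of n P y] by blast
  \<comment> \<open>The multiplicities may add up to less than \<open>N\<close>. The surplus centres
    are arbitrary values of \<open>\<mu>\<close>; they only add nonnegative kernels to
    \<open>g\<close>, and only a lower bound is wanted.\<close>
  define F where "F x = (1 / real N) * (\<Sum>j=1..N. sigmoid ((x - \<mu> j) / s))" for x
  define g where "g x = (1 / real N) * (\<Sum>j=1..N. logistic_density ((x - \<mu> j) / s) / s)" for x
  have mix: "logistic_mixture F g"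
    unfolding logistic_mixture_def
    by (rule exI[of _ N], rule exI[of _ \<mu>], rule exI[of _ "\<lambda>_. s"])
      (use N(1) s in \<open>simp add: F_def[abs_def] g_def[abs_def]\<close>)
  moreover have "(1 - \<epsilon>) * f x \<le> g x" if x: "\<bar>x\<bar> \<le> M" for x
  proof -
    have xL: "x \<in> {-L..L}" "- L \<le> x - r" "x + r \<le> L" using x r L by auto
    \<comment> \<open>\<open>y a\<close> is the first grid point from \<open>x - r\<close> on and
      \<open>y b\<close> the last one up to \<open>x + r\<close>; between them they cover the points
      within \<open>r / 2\<close> of \<open>x\<close>.\<close>
    define a where "a = nat \<lceil>(x - r + L) / h\<rceil>"
    define b where "b = nat \<lfloor>(x + r + L) / h\<rfloor>"
    have a: "(x - r + L) / h \<le> real a" "real a \<le> (x - r + L) / h + 1"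
      using divide_nonneg_pos[of "x - r + L" h] xL h unfolding a_def by linarith+
    have b: "real b \<le> (x + r + L) / h" "(x + r + L) / h - 1 \<le> real b"
      using divide_nonneg_pos[of "x + r + L" h] xL h r unfolding b_def by linarith+
    have ya: "x - r \<le> y a" "y a \<le> x - r / 2" using a hr h by (simp_all add: y_def field_simps)
    have yb: "y b \<le> x + r" "x + r / 2 \<le> y b" using b hr h by (simp_all add: y_def field_simps)
    have ab: "a \<le> b"
    proof (rule ccontr)
      assume "\<not> a \<le> b"
      then have "y b \<le> y a" by (intro y_mono) simp
      then show False using ya yb r by linarith
    qed
    have bP: "b \<le> P"
    proof (rule ccontr)
      assume "\<not> b \<le> P"
      then have "y (Suc P) \<le> y b" by (intro y_mono) simp
      moreover have "y P = L" using Ph by (simp add: y_def)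
      ultimately show False using yb xL h by (simp add: y_Suc)
    qed
    have fx: "2 * e \<le> f x" "(1 - 2 * \<eta>) * f x \<le> f x - 2 * e"
    proof -
      have "f x0 \<le> f x" using x0 xL by simp
      then have "e \<le> \<eta> * f x" using \<eta> by (simp add: e_def)
      moreover have "\<eta> * f x \<le> (1/4) * f x" using \<eta> pos[of x] by (intro mult_right_mono) auto
      ultimately show "2 * e \<le> f x" "(1 - 2 * \<eta>) * f x \<le> f x - 2 * e"
        using pos[of x] by (simp_all only: left_diff_distrib mult_1_left mult.assoc)
    qed
    \<comment> \<open>One \<open>e\<close> is lost to the variation of \<open>f\<close> over the
      neighbourhood, the other to the rounding.\<close>
    have n_cell: "h * (f x - 2 * e) \<le> real (n m) / real N" if m: "m \<in> {a..<b}" for m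
    proof -
      have "h * (f x - e) \<le> w m"
      proof (rule w_ge)
        show "0 \<le> f x - e" using fx e by linarith
        fix z assume "z \<in> {y m..<y (Suc m)}"
        then have z: "x - r \<le> z" "z \<le> x + r"
          using ya yb y_mono[of a m] y_mono[of "Suc m" b] m by auto
        then have "dist (f z) (f x) < e"
          using xL r by (intro d) (auto simp: dist_real_def)
        then show "f x - e \<le> f z" by (auto simp: dist_real_def)
      qed
      moreover have "w m - 1 / real N \<le> real (n m) / real N"
        using divide_right_mono[OF n_ge[of m], of "real N"] N(1) by (simp add: diff_divide_distrib)
      ultimately show ?thesis using Nh by (simp add: algebra_simps)
    qed
    define k where "k m = logistic_density ((x - y m) / s) / s" for m
    have k0: "0 \<le> k m" for m
      using s logistic_density_pos by (simp add: k_def less_imp_le)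
    have k_ge: "(1 - \<eta>) * (sigmoid ((y (Suc m) - x) / s) - sigmoid ((y m - x) / s)) \<le> h * k m" for m
    proof -
      have "sigmoid ((y (Suc m) - x) / s) - sigmoid ((y m - x) / s) \<le> (h / s) * exp (h / s) * logistic_density ((y m - x) / s)"
        using sigmoid_increment_le[of "(y m - x) / s" "(y (Suc m) - x) / s"] h s
        by (simp add: y_Suc divide_right_mono diff_divide_distrib[symmetric])
      also have "logistic_density ((y m - x) / s) = logistic_density ((x - y m) / s)"
        using logistic_density_minus[of "(x - y m) / s"] by (simp add: minus_divide_left)
      finally have *: "sigmoid ((y (Suc m) - x) / s) - sigmoid ((y m - x) / s) \<le> exp (h / s) * (h * k m)"
        by (simp add: k_def mult_ac)
      \<comment> \<open>The factor \<open>1 - \<eta>\<close>, at most \<open>exp (- \<eta>)\<close>,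
        pays for the Harnack factor.\<close>
      have "(1 - \<eta>) * exp (h / s) \<le> 1"
      proof -
        have "1 - \<eta> \<le> exp (- \<eta>)" using exp_ge_add_one_self[of "- \<eta>"] by simp
        moreover have "exp (h / s) \<le> exp \<eta>" using hs s by (simp add: field_simps)
        ultimately have "(1 - \<eta>) * exp (h / s) \<le> exp (- \<eta>) * exp \<eta>" using \<eta> by (intro mult_mono) auto
        then show ?thesis by (simp add: exp_minus)
      qed
      then have "(1 - \<eta>) * exp (h / s) * (h * k m) \<le> h * k m"
        using h k0[of m] by (intro mult_left_le_one_le) (use \<eta> in auto)
      moreover have "(1 - \<eta>) * (sigmoid ((y (Suc m) - x) / s) - sigmoid ((y m - x) / s)) \<le> (1 - \<eta>) * (exp (h / s) * (h * k m))"
        using * \<eta> by (intro mult_left_mono) auto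
      ultimately show ?thesis by (simp add: mult.assoc)
    qed
    have tele: "1 - \<eta> \<le> (\<Sum>m=a..<b. sigmoid ((y (Suc m) - x) / s) - sigmoid ((y m - x) / s))"
    proof -
      have "(\<Sum>m=a..<b. sigmoid ((y (Suc m) - x) / s) - sigmoid ((y m - x) / s)) =
          sigmoid ((y b - x) / s) - sigmoid ((y a - x) / s)"
        using ab by (rule sum_Suc_diff')
      moreover have "sigmoid (r / (2 * s)) \<le> sigmoid ((y b - x) / s)"
        using yb s divide_right_mono[of "r / 2" "y b - x" s] by (intro sigmoid_mono) simp
      moreover have "sigmoid ((y a - x) / s) \<le> sigmoid (- (r / (2 * s)))"
        using ya s divide_right_mono[of "y a - x" "- (r / 2)" s] by (intro sigmoid_mono) simp
      ultimately show ?thesis using sig by linarith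
    qed
    have "(1 - \<epsilon>) * f x \<le> ((1 - 2 * \<eta>) * f x) * ((1 - \<eta>) * (1 - \<eta>))"
    proof -
      have "1 - \<epsilon> \<le> (1 - 2 * \<eta>) * ((1 - \<eta>) * (1 - \<eta>))"
      proof -
        have "(1 - 2 * \<eta>) * ((1 - \<eta>) * (1 - \<eta>)) - (1 - 4 * \<eta>) = \<eta> * \<eta> * (5 - 2 * \<eta>)"
          by (simp add: algebra_simps)
        moreover have "0 \<le> \<eta> * \<eta> * (5 - 2 * \<eta>)" using \<eta> by (intro mult_nonneg_nonneg) auto
        ultimately show ?thesis unfolding \<eta>_def by linarith
      qed
      then have "(1 - \<epsilon>) * f x \<le> (1 - 2 * \<eta>) * ((1 - \<eta>) * (1 - \<eta>)) * f x"
        using pos[of x] by (intro mult_right_mono) auto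
      then show ?thesis by (simp add: mult_ac)
    qed
    also have "\<dots> \<le> (f x - 2 * e) * ((1 - \<eta>) * (\<Sum>m=a..<b. sigmoid ((y (Suc m) - x) / s) - sigmoid ((y m - x) / s)))"
      using fx tele \<eta> pos[of x] by (intro mult_mono mult_nonneg_nonneg) auto
    also have "\<dots> = (f x - 2 * e) * (\<Sum>m=a..<b. (1 - \<eta>) * (sigmoid ((y (Suc m) - x) / s) - sigmoid ((y m - x) / s)))"
      by (simp only: sum_distrib_left)
    also have "\<dots> \<le> (f x - 2 * e) * (\<Sum>m=a..<b. h * k m)"
      using fx by (intro mult_left_mono sum_mono k_ge) auto
    also have "\<dots> = (\<Sum>m=a..<b. (h * (f x - 2 * e)) * k m)"
      by (simp add: sum_distrib_left mult_ac)
    also have "\<dots> \<le> (\<Sum>m=a..<b. (real (n m) / real N) * k m)"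
      by (intro sum_mono mult_right_mono n_cell k0)
    also have "\<dots> \<le> (\<Sum>m<P. (real (n m) / real N) * k m)"
      using bP k0 by (intro sum_mono2) auto
    also have "\<dots> = (1 / real N) * (\<Sum>m<P. real (n m) * k m)"
      by (simp add: sum_distrib_left)
    also have "\<dots> = (1 / real N) * (\<Sum>j=1..(\<Sum>m<P. n m). logistic_density ((x - \<mu> j) / s) / s)"
      unfolding k_def by (subst \<mu>[of "\<lambda>c. logistic_density ((x - c) / s) / s"]) simp
    also have "\<dots> \<le> g x"
      unfolding g_def using n_sum s
      by (intro mult_left_mono sum_mono2) (auto intro!: divide_nonneg_pos less_imp_le[OF logistic_density_pos])
    finally show ?thesis .
  qed
  ultimately show ?thesis by (rule that)
qed

section \<open>The greedy flow\<close>

text \<open>The transpose of an orthogonal matrix sending a coordinate vector to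
  \<open>\<theta>\<close>. It makes every one-dimensional projection a coordinate on which a layer
  can act.\<close>

lemma orthogonal_matrix_exists_row:
  fixes \<theta> :: "real^'n"
  assumes "norm \<theta> = 1"
  obtains R where "orthogonal_matrix R" "\<And>x. (R *v x) $ k = \<theta> \<bullet> x"
proof -
  obtain A :: "real^'n^'n" where A: "orthogonal_matrix A" "A *v axis k 1 = \<theta>"
    using orthogonal_matrix_exists_basis[OF assms, of k] .
  have "orthogonal_matrix (transpose A)"
    using A(1) by simp
  moreover have "(transpose A *v x) $ k = \<theta> \<bullet> x" for x
  proof -
    have "(transpose A *v x) $ k = axis k 1 \<bullet> (transpose A *v x)"
      by (simp add: inner_axis' del: transpose_matrix_vector)
    also have "\<dots> = (A *v axis k 1) \<bullet> x"
      by (metis dot_lmul_matrix inner_commute transpose_matrix_vector)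
    finally show ?thesis by (simp add: A)
  qed
  ultimately show ?thesis by (rule that)
qed

text \<open>Rotation invariance turns the projection onto \<open>\<theta>\<close> into a coordinate,
  whose law is known.\<close>

lemma distr_std_gaussian_inner:
  fixes \<theta> :: "real^'n"
  assumes "norm \<theta> = 1"
  shows "distr std_gaussian borel (\<lambda>x. \<theta> \<bullet> x) = density lborel std_normal_density"
proof -
  fix k :: 'n
  obtain R :: "real^'n^'n" where R: "orthogonal_matrix R" "\<And>x. (R *v x) $ k = \<theta> \<bullet> x"
    using orthogonal_matrix_exists_row[OF assms, of k] by metis
  have "distr std_gaussian borel (\<lambda>x. \<theta> \<bullet> x) = distr (std_gaussian :: (real^'n) measure) borel (\<lambda>x. x $ k)"
  proof (rule measure_eqI)
    fix A assume "A \<in> sets (distr std_gaussian borel (\<lambda>x. \<theta> \<bullet> x))"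
    then have [measurable]: "A \<in> sets borel" by simp
    have "emeasure (distr std_gaussian borel (\<lambda>x. \<theta> \<bullet> x)) A =
        (\<integral>\<^sup>+x. indicator A ((R *v x) $ k) \<partial>(std_gaussian :: (real^'n) measure))"
      unfolding R(2) by (subst nn_integral_indicator[symmetric], simp, subst nn_integral_distr) auto
    also have "\<dots> = (\<integral>\<^sup>+x. indicator A (x $ k) \<partial>(std_gaussian :: (real^'n) measure))"
      by (rule std_gaussian_orthogonal[OF R(1), where f="\<lambda>x. indicator A (x $ k)"]) measurable
    also have "\<dots> = emeasure (distr (std_gaussian :: (real^'n) measure) borel (\<lambda>x. x $ k)) A"
      by (subst nn_integral_indicator[symmetric], simp, subst nn_integral_distr) auto
    finally show "emeasure (distr std_gaussian borel (\<lambda>x. \<theta> \<bullet> x)) A =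
        emeasure (distr (std_gaussian :: (real^'n) measure) borel (\<lambda>x. x $ k)) A" .
  qed simp
  then show ?thesis by (simp add: distr_std_gaussian_nth)
qed

section \<open>Dominated laws and the bound on the total gain\<close>

lemma gaussianization_step_orthogonal: "gaussianization_step \<Psi> R G \<Longrightarrow> orthogonal_matrix R"
  by (simp add: gaussianization_step_def)

text \<open>The hypothesis \<open>dominated\<close> says that the law has a density bounded by \<open>Q\<close> with respect to
  the Gaussian.\<close>

locale compactly_supported_law = prob_space \<mu>
  for \<mu> :: "(real^'n) measure" +
  fixes K :: "(real^'n) set" and Q :: real
  assumes sets_law [measurable_cong]: "sets \<mu> = sets borel"
    and compact_support: "compact K"
    and AE_support: "AE x in \<mu>. x \<in> K"
    and Q_nonneg: "0 \<le> Q"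
    and dominated: "H \<in> borel_measurable borel \<Longrightarrow> (\<integral>\<^sup>+x. H x \<partial>\<mu>) \<le> ennreal Q * (\<integral>\<^sup>+x. H x \<partial>std_gaussian)"
begin

text \<open>A continuous function is bounded on the compact set carrying the law. Hence all gains
  are finite, although the exponents may be unbounded on the whole space.\<close>

lemma integrable_continuous:
  fixes g :: "real^'n \<Rightarrow> real"
  assumes "continuous_on UNIV g"
  shows "integrable \<mu> g"
proof -
  have "bounded (g ` K)"
    by (intro compact_imp_bounded compact_continuous_image continuous_on_subset[OF assms] compact_support) simp
  then obtain B where "\<And>x. x \<in> K \<Longrightarrow> norm (g x) \<le> B"
    unfolding bounded_iff by blast
  then show ?thesis
    using AE_support borel_measurable_continuous_onI[OF assms]
    by (intro integrable_const_bound[where B=B]) (auto elim: eventually_mono)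
qed

text \<open>\<open>W\<close> is the log density ratio in the change of variables for
  \<open>T\<close>. The form with test functions \<open>H\<close> lets maps be composed by
  substituting for \<open>H\<close>.\<close>

definition pullback_weight :: "(real^'n \<Rightarrow> real^'n) \<Rightarrow> (real^'n \<Rightarrow> real) \<Rightarrow> bool" where
  "pullback_weight T W \<longleftrightarrow> continuous_on UNIV T \<and> continuous_on UNIV W \<and>
     (\<forall>H :: real^'n \<Rightarrow> ennreal. H \<in> borel_measurable borel \<longrightarrow>
        (\<integral>\<^sup>+x. ennreal (exp (W x)) * H (T x) \<partial>std_gaussian) = (\<integral>\<^sup>+x. H x \<partial>std_gaussian))"

lemma pullback_weightD:
  assumes "pullback_weight T W" "H \<in> borel_measurable borel"
  shows "(\<integral>\<^sup>+x. ennreal (exp (W x)) * H (T x) \<partial>std_gaussian) = (\<integral>\<^sup>+x. H x \<partial>std_gaussian)"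
  using assms by (simp add: pullback_weight_def)

lemma pullback_weight_id: "pullback_weight (\<lambda>x. x) (\<lambda>x. 0)"
  by (simp add: pullback_weight_def)

text \<open>The chain rule: the weight of \<open>T\<close> is applied to the test function that
  contains \<open>exp G\<close> and the new step, and then the change of variables of the step
  itself.\<close>

lemma pullback_weight_step:
  assumes TW: "pullback_weight T W" and step: "gaussianization_step \<Psi> R G"
  shows "pullback_weight (\<lambda>x. \<Psi> (R *v T x)) (\<lambda>x. W x + G (T x))"
proof -
  note cont = gaussianization_step_continuous[OF step]
  have T: "continuous_on UNIV T" and W: "continuous_on UNIV W"
    using TW by (auto simp: pullback_weight_def)
  have [measurable]: "G \<in> borel_measurable borel" "(\<lambda>x. \<Psi> (R *v x)) \<in> borel_measurable borel"
    "W \<in> borel_measurable borel" "T \<in> borel_measurable borel"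
    by (intro borel_measurable_continuous_onI cont T W)+
  have "(\<integral>\<^sup>+x. ennreal (exp (W x + G (T x))) * H (\<Psi> (R *v T x)) \<partial>std_gaussian) =
      (\<integral>\<^sup>+x. H x \<partial>std_gaussian)" if [measurable]: "H \<in> borel_measurable borel" for H :: "real^'n \<Rightarrow> ennreal"
  proof -
    have "(\<integral>\<^sup>+x. ennreal (exp (W x + G (T x))) * H (\<Psi> (R *v T x)) \<partial>std_gaussian) =
        (\<integral>\<^sup>+x. ennreal (exp (W x)) * (ennreal (exp (G (T x))) * H (\<Psi> (R *v T x))) \<partial>std_gaussian)"
      by (simp add: exp_add ennreal_mult mult.assoc)
    also have "\<dots> = (\<integral>\<^sup>+x. ennreal (exp (G x)) * H (\<Psi> (R *v x)) \<partial>std_gaussian)"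
      by (rule pullback_weightD[OF TW, where H="\<lambda>x. ennreal (exp (G x)) * H (\<Psi> (R *v x))"]) measurable
    also have "\<dots> = (\<integral>\<^sup>+x. H x \<partial>std_gaussian)"
      by (rule gaussianization_step_nn_integral[OF step]) measurable
    finally show ?thesis .
  qed
  then show ?thesis
    unfolding pullback_weight_def
    using continuous_on_compose2[OF cont(1) T subset_UNIV] continuous_on_compose2[OF cont(2) T subset_UNIV] W
    by (auto intro: continuous_on_add)
qed

text \<open>The bound is the same for all \<open>T\<close>, which caps the gain that any number of
  steps can accumulate.\<close>

lemma pullback_weight_bound:
  assumes "pullback_weight T W"
  shows "expectation W \<le> Q"
proof -
  have W: "continuous_on UNIV W" using assms by (simp add: pullback_weight_def)
  have [measurable]: "W \<in> borel_measurable borel"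
    by (rule borel_measurable_continuous_onI[OF W])
  have eW: "integrable \<mu> (\<lambda>x. exp (W x))"
    by (intro integrable_continuous continuous_on_exp W)
  have 1: "(\<integral>\<^sup>+x. ennreal (exp (W x)) \<partial>std_gaussian) = 1"
    using pullback_weightD[OF assms, of "\<lambda>_. 1"]
      prob_space.emeasure_space_1[OF prob_space_std_gaussian[where 'n='n]] by simp
  have "expectation W \<le> expectation (\<lambda>x. exp (W x))"
  proof (rule integral_mono[OF integrable_continuous[OF W] eW])
    show "W x \<le> exp (W x)" for x using exp_ge_add_one_self[of "W x"] by linarith
  qed
  also have "\<dots> \<le> Q"
  proof -
    have "ennreal (expectation (\<lambda>x. exp (W x))) = (\<integral>\<^sup>+x. ennreal (exp (W x)) \<partial>\<mu>)"
      by (rule nn_integral_eq_integral[symmetric]) (auto simp: eW)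
    also have "\<dots> \<le> ennreal Q"
      using dominated[of "\<lambda>x. ennreal (exp (W x))"] by (simp add: 1)
    finally show ?thesis
      using Q_nonneg by simp
  qed
  finally show ?thesis .
qed

section \<open>Available gains and the greedy choice\<close>

lemma gaussianization_step_approx:
  fixes f :: "'n \<Rightarrow> real \<Rightarrow> real"
  assumes R: "orthogonal_matrix R" and T: "continuous_on UNIV T"
    and cont: "\<And>i. continuous_on UNIV (f i)" and pos: "\<And>i x. 0 < f i x"
    and int: "\<And>i. (\<integral>\<^sup>+x. ennreal (f i x) \<partial>lborel) = 1" and e: "0 < e"
  obtains \<Psi> G where "gaussianization_step \<Psi> R G"
    "expectation (\<lambda>x. \<Sum>i\<in>UNIV. ln (f i ((R *v T x) $ i) / std_normal_density ((R *v T x) $ i))) - e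
      \<le> expectation (\<lambda>x. G (T x))"
proof -
  \<comment> \<open>Each of the \<open>CARD('n)\<close> logarithms may lose \<open>c\<close>, which
    adds up to \<open>e\<close>.\<close>
  define c where "c = e / real CARD('n)"
  have c: "0 < c" using e by (simp add: c_def)
  have RT: "continuous_on UNIV (\<lambda>x. R *v T x)"
    by (rule continuous_on_compose2[OF linear_continuous_on[OF matrix_vector_mul_bounded_linear[of R], of UNIV] T subset_UNIV])
  have RTi: "continuous_on UNIV (\<lambda>x. (R *v T x) $ i)" for i
    by (rule continuous_on_component[OF RT])
  \<comment> \<open>The transported law lives on a compact image, so the mixtures have to dominate
    \<open>exp (- c)\<close> times the target densities on a bounded interval only.\<close>
  have "bounded ((\<lambda>x. R *v T x) ` K)"
    by (intro compact_imp_bounded compact_continuous_image continuous_on_subset[OF RT] compact_support) simp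
  then obtain M where M: "\<And>x. x \<in> K \<Longrightarrow> norm (R *v T x) \<le> M"
    unfolding bounded_iff by blast
  have "\<exists>F g. logistic_mixture F g \<and> (\<forall>x. \<bar>x\<bar> \<le> M \<longrightarrow> exp (- c) * f i x \<le> g x)" for i
  proof -
    obtain F g where "logistic_mixture F g" "\<And>x. \<bar>x\<bar> \<le> M \<Longrightarrow> (1 - (1 - exp (- c))) * f i x \<le> g x"
      by (rule logistic_mixture_approx[OF cont[of i] pos int[of i], of "1 - exp (- c)" M]) (use c in auto)
    then show ?thesis by auto
  qed
  then obtain F g where Fg: "\<And>i. logistic_mixture (F i) (g i)"
    "\<And>i x. \<bar>x\<bar> \<le> M \<Longrightarrow> exp (- c) * f i x \<le> g i x"
    by metis
  define \<Psi> where "\<Psi> = (\<lambda>x::real^'n. \<chi> i. Phi_inv (F i (x $ i)))"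
  define G where "G = (\<lambda>x. \<Sum>i\<in>UNIV. ln (g i ((R *v x) $ i) / std_normal_density ((R *v x) $ i)))"
  have step: "gaussianization_step \<Psi> R G"
    unfolding gaussianization_step_def \<Psi>_def G_def
    by (intro conjI R, rule exI[of _ F], rule exI[of _ g]) (simp add: Fg)
  have GT: "continuous_on UNIV (\<lambda>x. G (T x))"
    by (rule continuous_on_compose2[OF gaussianization_step_continuous(2)[OF step] T]) simp
  let ?S = "\<lambda>x. \<Sum>i\<in>UNIV. ln (f i ((R *v T x) $ i) / std_normal_density ((R *v T x) $ i))"
  have S: "continuous_on UNIV ?S"
  proof (intro continuous_on_sum)
    fix i :: 'n
    have "continuous_on UNIV (\<lambda>x. ln (f i x / std_normal_density x))"
      using cont[of i] pos[of i] unfolding std_normal_density_def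
      by (intro continuous_intros) (auto simp: less_imp_neq[symmetric])
    from continuous_on_compose2[OF this RTi subset_UNIV]
    show "continuous_on UNIV (\<lambda>x. ln (f i ((R *v T x) $ i) / std_normal_density ((R *v T x) $ i)))" .
  qed
  have "expectation ?S - e = expectation (\<lambda>x. ?S x - e)"
    using integrable_continuous[OF S] by (simp add: prob_space)
  also have "\<dots> \<le> expectation (\<lambda>x. G (T x))"
  proof (rule integral_mono_AE)
    show "integrable \<mu> (\<lambda>x. ?S x - e)"
      using integrable_continuous[OF S] by simp
    show "integrable \<mu> (\<lambda>x. G (T x))"
      by (rule integrable_continuous[OF GT])
    show "AE x in \<mu>. ?S x - e \<le> G (T x)"
      using AE_support
    proof eventually_elim
      case (elim x)
      have "ln (f i ((R *v T x) $ i) / std_normal_density ((R *v T x) $ i)) - c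
          \<le> ln (g i ((R *v T x) $ i) / std_normal_density ((R *v T x) $ i))" for i
      proof -
        let ?z = "(R *v T x) $ i"
        have "\<bar>?z\<bar> \<le> M" using M[OF elim] component_le_norm_cart[of "R *v T x" i] by linarith
        then have *: "exp (- c) * f i ?z \<le> g i ?z" by (rule Fg)
        have "ln (exp (- c) * f i ?z) \<le> ln (g i ?z)"
          using * pos[of i ?z] logistic_mixture_density_pos[OF Fg(1), of i ?z] by (subst ln_le_cancel_iff) auto
        then show ?thesis
          using pos[of i ?z] logistic_mixture_density_pos[OF Fg(1), of i ?z] normal_density_pos[of 1 0 ?z]
          by (simp add: ln_mult ln_div)
      qed
      then have "(\<Sum>i\<in>UNIV. ln (f i ((R *v T x) $ i) / std_normal_density ((R *v T x) $ i)) - c) \<le> G (T x)"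
        unfolding G_def by (rule sum_mono)
      then show ?case
        by (simp add: sum_subtractf c_def)
    qed
  qed
  finally show ?thesis
    using step that by blast
qed

lemma gaussianization_step_direction:
  fixes v :: "real \<Rightarrow> real" and \<theta> :: "real^'n"
  assumes \<theta>: "norm \<theta> = 1" and T: "continuous_on UNIV T"
    and cont: "continuous_on UNIV v" and pos: "\<And>x. 0 < v x"
    and int: "(\<integral>\<^sup>+x. ennreal (std_normal_density x * v x) \<partial>lborel) = 1" and e: "0 < e"
  obtains \<Psi> R G where "gaussianization_step \<Psi> R G"
    "expectation (\<lambda>x. ln (v (\<theta> \<bullet> T x))) - e \<le> expectation (\<lambda>x. G (T x))"
proof -
  fix k :: 'n
  obtain R :: "real^'n^'n" where R: "orthogonal_matrix R" and Rk: "\<And>x. (R *v x) $ k = \<theta> \<bullet> x"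
    using orthogonal_matrix_exists_row[OF \<theta>, of k] by metis
  \<comment> \<open>Only the coordinate aligned with \<open>\<theta>\<close> is tilted by
    \<open>v\<close>; in the others the target is the normal density, whose log ratio
    vanishes.\<close>
  define f where "f i x = std_normal_density x * (if i = k then v x else 1)" for i x
  have fc: "continuous_on UNIV (f i)" for i
    unfolding f_def std_normal_density_def
    by (cases "i = k") (auto intro!: continuous_intros cont)
  have fp: "0 < f i x" for i x
    using pos by (simp add: f_def normal_density_pos)
  have fi: "(\<integral>\<^sup>+x. ennreal (f i x) \<partial>lborel) = 1" for i
    by (cases "i = k") (simp_all add: f_def int nn_integral_std_normal_density)
  obtain \<Psi> G where \<Psi>G: "gaussianization_step \<Psi> R G"
    "expectation (\<lambda>x. \<Sum>i\<in>UNIV. ln (f i ((R *v T x) $ i) / std_normal_density ((R *v T x) $ i))) - e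
      \<le> expectation (\<lambda>x. G (T x))"
    by (rule gaussianization_step_approx[OF R T fc fp fi e])
  have "(\<Sum>i\<in>UNIV. ln (f i (z $ i) / std_normal_density (z $ i))) = ln (v (z $ k))" for z
  proof -
    have "ln (f i (z $ i) / std_normal_density (z $ i)) = (if i = k then ln (v (z $ k)) else 0)" for i
      using normal_density_pos[of 1 0 "z $ i"] by (simp add: f_def)
    then show ?thesis by simp
  qed
  then have "expectation (\<lambda>x. ln (v (\<theta> \<bullet> T x))) - e \<le> expectation (\<lambda>x. G (T x))"
    using \<Psi>G(2) by (simp add: Rk)
  with \<Psi>G(1) show ?thesis by (rule that)
qed

text \<open>Approximating the Gaussian itself loses arbitrarily little. This makes the set of
  available gains nonempty and bounds its supremum below by 0. The direction is an arbitrary unit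
  vector.\<close>

lemma gaussianization_step_neutral:
  fixes T :: "real^'n \<Rightarrow> real^'n"
  assumes T: "continuous_on UNIV T" and e: "0 < e"
  obtains \<Psi> R G where "gaussianization_step \<Psi> R G" "- e \<le> expectation (\<lambda>x. G (T x))"
proof (rule gaussianization_step_direction[of "axis undefined 1" T "\<lambda>_. 1" e])
  show "(\<integral>\<^sup>+x. ennreal (std_normal_density x * 1) \<partial>lborel) = 1"
    by (simp add: nn_integral_std_normal_density)
  fix \<Psi> R G
  assume "gaussianization_step \<Psi> R G" "expectation (\<lambda>x. ln 1) - e \<le> expectation (\<lambda>x. G (T x))"
  then show thesis
    by (intro that) simp_all
qed (use T e in simp_all)

text \<open>After any further step the expected weight is still at most \<open>Q\<close>, so the
  gains available at \<open>T\<close> are bounded by \<open>Q - expectation W\<close> and their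
  supremum can be approached.\<close>

lemma gaussianization_step_greedy:
  assumes TW: "pullback_weight T W" and e: "0 < e"
  obtains \<Psi> R G where "gaussianization_step \<Psi> R G"
    "\<forall>\<Psi>' R' G'. gaussianization_step \<Psi>' R' G' \<longrightarrow> expectation (\<lambda>x. G' (T x)) \<le> expectation (\<lambda>x. G (T x)) + e"
proof -
  define S where "S = {expectation (\<lambda>x. G (T x)) | G. \<exists>\<Psi> R. gaussianization_step \<Psi> R G}"
  have T: "continuous_on UNIV T" and W: "continuous_on UNIV W"
    using TW by (auto simp: pullback_weight_def)
  obtain \<Psi>0 R0 G0 where "gaussianization_step \<Psi>0 R0 G0" "- 1 \<le> expectation (\<lambda>x. G0 (T x))"
    by (rule gaussianization_step_neutral[OF T zero_less_one])
  then have "S \<noteq> {}"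
    unfolding S_def by blast
  have "y \<le> Q - expectation W" if "y \<in> S" for y
  proof -
    from that obtain G \<Psi> R where y: "y = expectation (\<lambda>x. G (T x))" and step: "gaussianization_step \<Psi> R G"
      unfolding S_def by blast
    have "integrable \<mu> (\<lambda>x. G (T x))"
      using continuous_on_compose2[OF gaussianization_step_continuous(2)[OF step] T subset_UNIV]
      by (rule integrable_continuous)
    then have "expectation (\<lambda>x. W x + G (T x)) = expectation W + y"
      using integrable_continuous[OF W] by (simp add: y)
    then show ?thesis
      using pullback_weight_bound[OF pullback_weight_step[OF TW step]] by simp
  qed
  then have bdd: "bdd_above S" by (rule bdd_aboveI)
  obtain y where y: "y \<in> S" "Sup S - e < y"
    using less_cSupE[of "Sup S - e" S] \<open>S \<noteq> {}\<close> e by auto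
  then obtain G \<Psi> R where G: "y = expectation (\<lambda>x. G (T x))" "gaussianization_step \<Psi> R G"
    unfolding S_def by blast
  show ?thesis
  proof (rule that[OF G(2)], intro allI impI)
    fix \<Psi>' :: "real^'n \<Rightarrow> real^'n" and R' G' assume "gaussianization_step \<Psi>' R' G'"
    then have "expectation (\<lambda>x. G' (T x)) \<in> S" unfolding S_def by blast
    then have "expectation (\<lambda>x. G' (T x)) \<le> Sup S" by (rule cSup_upper[OF _ bdd])
    with y G(1) show "expectation (\<lambda>x. G' (T x)) \<le> expectation (\<lambda>x. G (T x)) + e" by linarith
  qed
qed

text \<open>The chosen gains telescope to the expectation of the accumulated weight, which is at
  most \<open>Q\<close>. Gain plus tolerance is a nonnegative bound \<open>b\<close> on every
  available gain, hence \<open>b\<close> is summable and tends to 0.\<close>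

lemma greedy_flow:
  obtains \<Psi> R b where "\<forall>k\<ge>1. marginal_gaussianization_layer (\<Psi> k) \<and> orthogonal_matrix (R k)"
    "\<forall>k. continuous_on UNIV (flow \<Psi> R k)" "b \<longlonglongrightarrow> 0"
    "\<forall>k \<Psi>' R' G'. gaussianization_step \<Psi>' R' G' \<longrightarrow> expectation (\<lambda>x. G' (flow \<Psi> R k x)) \<le> b k"
proof -
  \<comment> \<open>The state of the recursion is the map so far together with its weight; the
    clause for \<open>n = 0\<close> pins the start to the identity with weight 0.\<close>
  let ?P = "\<lambda>n TW. pullback_weight (fst TW) (snd TW) \<and> (n = 0 \<longrightarrow> TW = (\<lambda>x. x, \<lambda>x. 0))"
  define greedy where "greedy n TW TW' \<Psi> R G \<longleftrightarrow> gaussianization_step \<Psi> R G \<and>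
     fst TW' = (\<lambda>x. \<Psi> (R *v fst TW x)) \<and> snd TW' = (\<lambda>x. snd TW x + G (fst TW x)) \<and>
     (\<forall>\<Psi>' R' G'. gaussianization_step \<Psi>' R' G' \<longrightarrow>
        expectation (\<lambda>x. G' (fst TW x)) \<le> expectation (\<lambda>x. G (fst TW x)) + (1/2) ^ n)"
    for n and TW TW' :: "(real^'n \<Rightarrow> real^'n) \<times> (real^'n \<Rightarrow> real)" and \<Psi> R G
  have "\<exists>TW. \<forall>n. ?P n (TW n) \<and> (\<exists>\<Psi> R G. greedy n (TW n) (TW (Suc n)) \<Psi> R G)"
  proof (rule dependent_nat_choice)
    show "\<exists>TW. ?P 0 TW" using pullback_weight_id by auto
    fix TW and n :: nat assume P: "?P n TW"
    then have pw: "pullback_weight (fst TW) (snd TW)" by (rule conjunct1)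
    have e: "0 < (1/2 :: real) ^ n" by simp
    obtain \<Psi> R G where step: "gaussianization_step \<Psi> R G"
      "\<forall>\<Psi>' R' G'. gaussianization_step \<Psi>' R' G' \<longrightarrow>
        expectation (\<lambda>x. G' (fst TW x)) \<le> expectation (\<lambda>x. G (fst TW x)) + (1/2) ^ n"
      by (rule gaussianization_step_greedy[OF pw e])
    let ?TW = "(\<lambda>x. \<Psi> (R *v fst TW x), \<lambda>x. snd TW x + G (fst TW x))"
    have "?P (Suc n) ?TW" using pullback_weight_step[OF pw step(1)] by simp
    moreover have "greedy n TW ?TW \<Psi> R G" using step by (simp add: greedy_def)
    ultimately show "\<exists>TW'. ?P (Suc n) TW' \<and> (\<exists>\<Psi> R G. greedy n TW TW' \<Psi> R G)" by blast
  qed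
  then obtain TW where TW: "\<And>n. ?P n (TW n)" and "\<forall>n. \<exists>\<Psi> R G. greedy n (TW n) (TW (Suc n)) \<Psi> R G"
    by blast
  then obtain \<Psi> R G where step: "\<And>n. greedy n (TW n) (TW (Suc n)) (\<Psi> n) (R n) (G n)"
    by metis
  define T where "T n = fst (TW n)" for n
  define W where "W n = snd (TW n)" for n
  have pw: "pullback_weight (T n) (W n)" for n
    using TW[of n] by (simp add: T_def W_def)
  have T: "continuous_on UNIV (T n)" and W: "continuous_on UNIV (W n)" for n
    using pw[of n] by (auto simp: pullback_weight_def)
  have T0: "T 0 = (\<lambda>x. x)" and W0: "W 0 = (\<lambda>x. 0)" using TW[of 0] by (auto simp: T_def W_def)
  have TSuc: "T (Suc n) = (\<lambda>x. \<Psi> n (R n *v T n x))" and WSuc: "W (Suc n) = (\<lambda>x. W n x + G n (T n x))" for n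
    using step[of n] by (auto simp: T_def W_def greedy_def)
  have gs: "gaussianization_step (\<Psi> n) (R n) (G n)" for n using step[of n] by (simp add: greedy_def)
  have gr: "expectation (\<lambda>x. G' (T n x)) \<le> expectation (\<lambda>x. G n (T n x)) + (1/2) ^ n"
    if "gaussianization_step \<Psi>' R' G'" for \<Psi>' R' G' n
    using step[of n] that by (simp add: T_def greedy_def)
  \<comment> \<open>\<open>flow\<close> numbers its layers from 1, the recursion numbers its steps
    from 0.\<close>
  define \<Psi>s where "\<Psi>s k = \<Psi> (k - 1)" for k
  define Rs where "Rs k = R (k - 1)" for k
  have flow: "flow \<Psi>s Rs k = T k" for k
  proof (induction k)
    case (Suc k)
    then show ?case by (simp add: fun_eq_iff TSuc \<Psi>s_def Rs_def)
  qed (simp add: fun_eq_iff T0)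
  define b where "b n = expectation (\<lambda>x. G n (T n x)) + (1/2) ^ n" for n
  \<comment> \<open>The neutral steps compete too, so the near-optimal gain plus its tolerance
    cannot be negative.\<close>
  have b0: "0 \<le> b n" for n
  proof (rule field_le_epsilon)
    fix e :: real assume "0 < e"
    obtain \<Psi>' R' G' where "gaussianization_step \<Psi>' R' G'" "- e \<le> expectation (\<lambda>x. G' (T n x))"
      by (rule gaussianization_step_neutral[OF T \<open>0 < e\<close>])
    then show "0 \<le> b n + e" using gr[of \<Psi>' R' G' n] unfolding b_def by linarith
  qed
  have ebW: "expectation (\<lambda>x. G n (T n x)) = expectation (W (Suc n)) - expectation (W n)" for n
  proof -
    have "integrable \<mu> (\<lambda>x. G n (T n x))"
      using continuous_on_compose2[OF gaussianization_step_continuous(2)[OF gs] T subset_UNIV]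
      by (rule integrable_continuous)
    then show ?thesis
      using integrable_continuous[OF W] by (simp add: WSuc)
  qed
  have "summable b"
  proof (rule summableI_nonneg_bounded[OF b0])
    fix n
    have "(\<Sum>k<n. expectation (\<lambda>x. G k (T k x))) = expectation (W n)"
      unfolding ebW by (simp add: sum_lessThan_telescope[where f="\<lambda>k. expectation (W k)"] W0)
    moreover have "(\<Sum>k<n. (1/2) ^ k :: real) \<le> (\<Sum>k. (1/2) ^ k)"
      by (rule sum_le_suminf) auto
    ultimately show "(\<Sum>k<n. b k) \<le> Q + (\<Sum>k. (1/2) ^ k)"
      using pullback_weight_bound[OF pw[of n]] by (simp add: b_def sum.distrib)
  qed
  then have "b \<longlonglongrightarrow> 0" by (rule summable_LIMSEQ_zero)
  show ?thesis
  proof (rule that[of \<Psi>s Rs b])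
    show "\<forall>k\<ge>1. marginal_gaussianization_layer (\<Psi>s k) \<and> orthogonal_matrix (Rs k)"
      unfolding \<Psi>s_def Rs_def
      by (intro allI impI conjI gaussianization_step_layer[OF gs] gaussianization_step_orthogonal[OF gs])
    show "\<forall>k. continuous_on UNIV (flow \<Psi>s Rs k)"
      unfolding flow by (intro allI T)
    show "\<forall>k \<Psi>' R' G'. gaussianization_step \<Psi>' R' G' \<longrightarrow> expectation (\<lambda>x. G' (flow \<Psi>s Rs k x)) \<le> b k"
      unfolding flow b_def by (intro allI impI gr)
  qed fact
qed

end

section \<open>Convergence from one-dimensional projections\<close>

text \<open>Finite sums of functions of a single linear form each, so their integrals are controlled
  by one-dimensional projections. The phase \<open>c\<close> provides sines and constants, and
  closes the class under products.\<close>

inductive trig_sum :: "(real^'n \<Rightarrow> real) \<Rightarrow> bool" where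
  cos: "trig_sum (\<lambda>x. r * cos (t \<bullet> x + c))"
| add: "trig_sum f \<Longrightarrow> trig_sum g \<Longrightarrow> trig_sum (\<lambda>x. f x + g x)"

lemma trig_sum_const: "trig_sum (\<lambda>x. r)"
  using trig_sum.cos[of r 0 0] by simp

text \<open>The product-to-sum formula turns a product of two cosines into cosines of the sum and
  the difference of the arguments.\<close>

lemma trig_sum_mult:
  assumes "trig_sum f" "trig_sum g"
  shows "trig_sum (\<lambda>x. f x * g x)"
proof -
  have base: "trig_sum (\<lambda>x. r * cos (t \<bullet> x + c) * g x)" if "trig_sum g" for r t c g
    using that
  proof induction
    case (cos r' t' c')
    have id: "r * cos a * (r' * cos b) = (r * r' / 2) * cos (a - b) + (r * r' / 2) * cos (a + b)" for a b :: real
      by (simp add: cos_diff cos_add algebra_simps)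
    have "r * cos (t \<bullet> x + c) * (r' * cos (t' \<bullet> x + c')) =
        (r * r' / 2) * cos ((t - t') \<bullet> x + (c - c')) + (r * r' / 2) * cos ((t + t') \<bullet> x + (c + c'))" for x
    proof -
      have "(t - t') \<bullet> x + (c - c') = (t \<bullet> x + c) - (t' \<bullet> x + c')"
        "(t + t') \<bullet> x + (c + c') = (t \<bullet> x + c) + (t' \<bullet> x + c')"
        by (simp_all add: inner_diff_left inner_add_left)
      then show ?thesis by (simp only: id)
    qed
    then show ?case
      by (simp only:) (intro trig_sum.add trig_sum.cos)
  next
    case (add f g)
    from trig_sum.add[OF add.IH] show ?case by (simp add: algebra_simps)
  qed
  from assms(1) show ?thesis
  proof induction
    case (add f f')
    from trig_sum.add[OF add.IH] show ?case by (simp add: algebra_simps)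
  qed (rule base[OF assms(2)])
qed

lemma trig_sum_sum:
  assumes "finite A" "\<And>i. i \<in> A \<Longrightarrow> trig_sum (f i)"
  shows "trig_sum (\<lambda>x. \<Sum>i\<in>A. f i x)"
  using assms by (induction A rule: finite_induct) (auto intro: trig_sum_const trig_sum.add)

lemma trig_sum_polynomial_sin:
  fixes P :: "real^'n \<Rightarrow> real"
  assumes "real_polynomial_function P"
  shows "trig_sum (\<lambda>x::real^'n. P (\<chi> i. sin (x $ i / l)))"
  using assms
proof induction
  case (linear f)
  \<comment> \<open>A linear functional of the sine vector is a combination of sines, each being a
    cosine shifted by \<open>- pi / 2\<close>.\<close>
  have "f (\<chi> i. sin (x $ i / l)) = (\<Sum>i\<in>UNIV. f (axis i 1) * cos (axis i (1 / l) \<bullet> x + (- pi / 2)))" for x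
  proof -
    have "(\<chi> i. sin (x $ i / l)) = (\<Sum>i\<in>UNIV. sin (x $ i / l) *\<^sub>R axis i 1)"
      by (simp add: vec_eq_iff axis_def if_distrib cong: if_cong)
    then have "f (\<chi> i. sin (x $ i / l)) = (\<Sum>i\<in>UNIV. sin (x $ i / l) * f (axis i 1))"
      using bounded_linear.linear[OF linear] by (simp add: linear_sum linear_scale)
    then show ?thesis
      by (simp add: inner_axis' cos_diff mult.commute)
  qed
  then show ?case
    by (simp only:) (intro trig_sum_sum trig_sum.cos finite)
qed (auto intro: trig_sum_const trig_sum.add trig_sum_mult)

lemma trig_sum_continuous: "trig_sum f \<Longrightarrow> continuous_on UNIV f"
  by (induction rule: trig_sum.induct) (intro continuous_intros | assumption)+

lemma trig_sum_bounded: "trig_sum f \<Longrightarrow> \<exists>B. \<forall>x. \<bar>f x\<bar> \<le> B"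
proof (induction rule: trig_sum.induct)
  case (cos r t c)
  show ?case
    by (rule exI[of _ "\<bar>r\<bar>"]) (simp add: abs_mult mult_left_le)
next
  case (add f g)
  then obtain A B where "\<And>x. \<bar>f x\<bar> \<le> A" "\<And>x. \<bar>g x\<bar> \<le> B" by blast
  then show ?case
    by (intro exI[of _ "A + B"] allI) (meson abs_triangle_ineq add_mono order_trans)
qed

lemma integrable_bounded_continuous:
  fixes f :: "real^'n \<Rightarrow> real"
  assumes "prob_space M" "sets M = sets borel" "continuous_on UNIV f" "\<And>x. \<bar>f x\<bar> \<le> B"
  shows "integrable M f"
proof -
  interpret prob_space M by fact
  have "f \<in> borel_measurable M"
    using borel_measurable_continuous_onI[OF assms(3)] assms(2) by (simp cong: measurable_cong_sets)
  then show ?thesis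
    using assms(4) by (intro integrable_const_bound[where B=B]) auto
qed

text \<open>The folding map \<open>x \<mapsto> l arcsin (sin (x / l))\<close> fixes \<open>[- l, l]\<close>, so a bounded continuous
  function agrees with its folding on a large cube, and the folding is a uniform limit of
  polynomials in the functions \<open>sin (x\<^sub>i / l)\<close>.\<close>

lemma trig_sum_approx:
  fixes f :: "real^'n \<Rightarrow> real"
  assumes f: "continuous_on UNIV f" and B: "\<And>x. \<bar>f x\<bar> \<le> B" and e: "0 < e" and l: "0 < l"
  obtains g where "trig_sum g"
    "\<forall>x. \<bar>f x - g x\<bar> \<le> e + 2 * B * (\<Sum>i\<in>UNIV. min 1 ((x $ i)\<^sup>2 / l\<^sup>2))"
proof -
  define fold where "fold s = (\<chi> i. l * arcsin (s $ i))" for s :: "real^'n"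
  have "continuous_on (cbox (- 1) (1 :: real^'n)) (\<lambda>s. f (fold s))"
    unfolding fold_def
    by (intro continuous_on_compose2[OF f] continuous_on_vec_lambda continuous_on_mult continuous_on_const
        continuous_on_arcsin continuous_on_component continuous_on_id) (auto simp: mem_box_cart)
  then obtain P where P: "real_polynomial_function P"
    "\<And>s. s \<in> cbox (- 1) (1 :: real^'n) \<Longrightarrow> \<bar>f (fold s) - P s\<bar> < e"
    using Stone_Weierstrass_real_polynomial_function[OF compact_cbox _ e] by blast
  have "\<bar>f x - P (\<chi> i. sin (x $ i / l))\<bar> \<le> e + 2 * B * (\<Sum>i\<in>UNIV. min 1 ((x $ i)\<^sup>2 / l\<^sup>2))" for x
  proof -
    let ?s = "\<chi> i. sin (x $ i / l)"
    have "\<bar>f (fold ?s) - P ?s\<bar> < e"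
      by (intro P) (simp add: mem_box_cart)
    moreover have "\<bar>f x - f (fold ?s)\<bar> \<le> 2 * B * (\<Sum>i\<in>UNIV. min 1 ((x $ i)\<^sup>2 / l\<^sup>2))"
    proof (cases "\<forall>i. \<bar>x $ i\<bar> \<le> l")
      case True
      have "l * arcsin (sin (x $ i / l)) = x $ i" for i
      proof -
        have "\<bar>x $ i / l\<bar> \<le> 1" using True l by simp
        then have "- (pi / 2) \<le> x $ i / l" "x $ i / l \<le> pi / 2" using pi_ge_two by linarith+
        then show ?thesis using l by (simp add: arcsin_sin)
      qed
      then have "fold ?s = x" by (simp add: fold_def vec_eq_iff)
      moreover have "0 \<le> B" using B[of 0] by linarith
      ultimately show ?thesis by (simp add: sum_nonneg)
    next
      \<comment> \<open>Outside the cube some summand equals 1, and the trivial bound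
        \<open>2 * B\<close> on the difference suffices.\<close>
      case False
      then obtain i where i: "l < \<bar>x $ i\<bar>" by (auto simp: not_le)
      then have "l\<^sup>2 \<le> (x $ i)\<^sup>2" using l by (intro abs_le_square_iff[THEN iffD1]) auto
      then have "1 \<le> min 1 ((x $ i)\<^sup>2 / l\<^sup>2)" using l by simp
      also have "\<dots> \<le> (\<Sum>i\<in>UNIV. min 1 ((x $ i)\<^sup>2 / l\<^sup>2))"
        by (rule member_le_sum) auto
      finally have "2 * B * 1 \<le> 2 * B * (\<Sum>i\<in>UNIV. min 1 ((x $ i)\<^sup>2 / l\<^sup>2))"
        using B[of 0] by (intro mult_left_mono) auto
      then show ?thesis using B[of x] B[of "fold ?s"] by linarith
    qed
    ultimately show ?thesis by linarith
  qed
  then show ?thesis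
    by (intro that[OF trig_sum_polynomial_sin[OF P(1)]] allI)
qed

text \<open>The Cramer-Wold device. Tightness needs no separate argument: the approximation error
  \<open>H l\<close> is itself a sum of bounded continuous functions of single coordinates, so its
  integrals converge to the one under \<open>L\<close>, which is small for large
  \<open>l\<close>.\<close>

lemma conv_in_distribution_ridge:
  fixes M :: "nat \<Rightarrow> (real^'n) measure"
  assumes M: "\<And>k. prob_space (M k)" "\<And>k. sets (M k) = sets borel"
    and L: "prob_space L" "sets L = sets borel"
    and ridge: "\<And>(\<theta>::real^'n) (h :: real \<Rightarrow> real). norm \<theta> = 1 \<Longrightarrow> continuous_on UNIV h \<Longrightarrow> bounded (range h) \<Longrightarrow>
      (\<lambda>k. \<integral>x. h (\<theta> \<bullet> x) \<partial>M k) \<longlonglongrightarrow> (\<integral>x. h (\<theta> \<bullet> x) \<partial>L)"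
  shows "conv_in_distribution M L"
proof -
  interpret L: prob_space L by fact
  have trig: "(\<lambda>k. \<integral>x. g x \<partial>M k) \<longlonglongrightarrow> (\<integral>x. g x \<partial>L)" if "trig_sum g" for g :: "real^'n \<Rightarrow> real"
    using that
  proof induction
    case (cos r t c)
    show ?case
    proof (cases "t = 0")
      case True
      then show ?thesis
        using prob_space.prob_space[OF M(1)] L.prob_space by simp
    next
      case False
      \<comment> \<open>The length of the frequency is moved into the one-variable function, since
        \<open>ridge\<close> speaks of unit directions.\<close>
      have "(\<lambda>k. \<integral>x. r * cos (norm t * ((t /\<^sub>R norm t) \<bullet> x) + c) \<partial>M k) \<longlonglongrightarrow>
          (\<integral>x. r * cos (norm t * ((t /\<^sub>R norm t) \<bullet> x) + c) \<partial>L)"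
      proof (rule ridge)
        show "norm (t /\<^sub>R norm t) = 1" using False by simp
        show "continuous_on UNIV (\<lambda>y. r * cos (norm t * y + c))" by (intro continuous_intros)
        show "bounded (range (\<lambda>y. r * cos (norm t * y + c)))"
          by (rule boundedI[of _ "\<bar>r\<bar>"]) (auto simp: abs_mult mult_left_le)
      qed
      moreover have "norm t * ((t /\<^sub>R norm t) \<bullet> x) = t \<bullet> x" for x using False by simp
      ultimately show ?thesis by (simp only:)
    qed
  next
    case (add f g)
    obtain A B where AB: "\<And>x. \<bar>f x\<bar> \<le> A" "\<And>x. \<bar>g x\<bar> \<le> B"
      using trig_sum_bounded add.hyps by meson
    have "integrable N f" "integrable N g" if "prob_space N" "sets N = sets borel" for N
      using that AB add.hyps by (auto intro: integrable_bounded_continuous trig_sum_continuous)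
    then show ?case
      using tendsto_add[OF add.IH] M L by simp
  qed
  define H where "H l x = (\<Sum>i\<in>UNIV. min 1 ((x $ i)\<^sup>2 / l\<^sup>2))" for l and x :: "real^'n"
  have Hc: "continuous_on UNIV (H l)" if "0 < l" for l
    unfolding H_def using that by (intro continuous_intros) auto
  have Hi: "\<bar>min 1 ((x $ i)\<^sup>2 / l\<^sup>2)\<bar> \<le> 1" for l and x :: "real^'n" and i by simp
  have Hb: "\<bar>H l x\<bar> \<le> real CARD('n)" for l x
  proof -
    have "\<bar>H l x\<bar> \<le> (\<Sum>i\<in>(UNIV::'n set). 1)"
      unfolding H_def by (rule order_trans[OF sum_abs sum_mono]) simp
    then show ?thesis by simp
  qed
  have Hint: "integrable N (H l)" if "prob_space N" "sets N = sets borel" "0 < l" for N l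
    using integrable_bounded_continuous[OF that(1,2) Hc[OF that(3)] Hb] .
  have Hlim: "(\<lambda>k. \<integral>x. H l x \<partial>M k) \<longlonglongrightarrow> (\<integral>x. H l x \<partial>L)" if l: "0 < l" for l
  proof -
    have int: "integrable N (\<lambda>x. min 1 ((x $ i)\<^sup>2 / l\<^sup>2))" if "prob_space N" "sets N = sets borel"
      for N :: "(real^'n) measure" and i
      using l by (intro integrable_bounded_continuous[OF that _ Hi] continuous_intros) auto
    have "(\<lambda>k. \<integral>x. min 1 ((x $ i)\<^sup>2 / l\<^sup>2) \<partial>M k) \<longlonglongrightarrow> (\<integral>x. min 1 ((x $ i)\<^sup>2 / l\<^sup>2) \<partial>L)" for i
    proof -
      have "(\<lambda>k. \<integral>x. min 1 ((axis i 1 \<bullet> x)\<^sup>2 / l\<^sup>2) \<partial>M k) \<longlonglongrightarrow> (\<integral>x. min 1 ((axis i 1 \<bullet> x)\<^sup>2 / l\<^sup>2) \<partial>L)"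
      proof (rule ridge)
        show "continuous_on UNIV (\<lambda>y. min 1 (y\<^sup>2 / l\<^sup>2))" using l by (intro continuous_intros) auto
        show "bounded (range (\<lambda>y. min 1 (y\<^sup>2 / l\<^sup>2)))"
          by (rule boundedI[of _ 1]) auto
      qed simp
      then show ?thesis by (simp add: inner_axis')
    qed
    then have "(\<lambda>k. \<Sum>i\<in>UNIV. \<integral>x. min 1 ((x $ i)\<^sup>2 / l\<^sup>2) \<partial>M k) \<longlonglongrightarrow> (\<Sum>i\<in>UNIV. \<integral>x. min 1 ((x $ i)\<^sup>2 / l\<^sup>2) \<partial>L)"
      by (intro tendsto_sum)
    then show ?thesis
      unfolding H_def by (simp add: int M L)
  qed
  have H0: "(\<lambda>j. \<integral>x. H (real (Suc j)) x \<partial>L) \<longlonglongrightarrow> (\<integral>x. 0 \<partial>L)"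
  proof (rule integral_dominated_convergence[where w="\<lambda>_. real CARD('n)"])
    show "H (real (Suc j)) \<in> borel_measurable L" for j
      using Hint[OF L, of "real (Suc j)"] by auto
    show "AE x in L. (\<lambda>j. H (real (Suc j)) x) \<longlonglongrightarrow> 0"
    proof (rule AE_I2)
      fix x :: "real^'n"
      have "(\<lambda>j. min 1 ((x $ i)\<^sup>2 / (real (Suc j))\<^sup>2)) \<longlonglongrightarrow> min 1 0" for i
        by (intro tendsto_min tendsto_const) real_asymp
      then have "(\<lambda>j. \<Sum>i\<in>UNIV. min 1 ((x $ i)\<^sup>2 / (real (Suc j))\<^sup>2)) \<longlonglongrightarrow> (\<Sum>i\<in>(UNIV::'n set). min 1 0)"
        by (intro tendsto_sum)
      then show "(\<lambda>j. H (real (Suc j)) x) \<longlonglongrightarrow> 0" by (simp add: H_def)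
    qed
  qed (use Hb in auto)
  show ?thesis
    unfolding conv_in_distribution_def
  proof (intro allI impI, elim conjE)
    fix f :: "real^'n \<Rightarrow> real" assume f: "continuous_on UNIV f" "bounded (range f)"
    then obtain B where B: "\<And>x. \<bar>f x\<bar> \<le> B" by (auto simp: bounded_iff)
    then have B0: "0 \<le> B" by (meson abs_ge_zero order_trans)
    have fint: "integrable N f" if "prob_space N" "sets N = sets borel" for N
      using integrable_bounded_continuous[OF that f(1) B] .
    show "(\<lambda>k. integral\<^sup>L (M k) f) \<longlonglongrightarrow> integral\<^sup>L L f"
    proof (rule tendstoI)
      fix e :: real assume "0 < e"
      \<comment> \<open>Replacing \<open>f\<close> by \<open>g\<close> costs at most
        \<open>d + 2 * B * d\<close> under \<open>M k\<close> and again under \<open>L\<close>, and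
        convergence for \<open>g\<close> costs \<open>d\<close>; together
        \<open>(3 + 4 * B) * d\<close>.\<close>
      define d where "d = e / (3 + 4 * B)"
      have d: "0 < d" "(3 + 4 * B) * d = e" using \<open>0 < e\<close> B0 by (auto simp: d_def)
      have "eventually (\<lambda>j. (\<integral>x. H (real (Suc j)) x \<partial>L) < d) sequentially"
        using order_tendstoD(2)[OF H0, of d] d by simp
      then obtain j where j: "(\<integral>x. H (real (Suc j)) x \<partial>L) < d"
        unfolding eventually_sequentially by blast
      define l where "l = real (Suc j)"
      have l: "0 < l" by (simp add: l_def)
      obtain g where g: "trig_sum g" "\<forall>x. \<bar>f x - g x\<bar> \<le> d + 2 * B * H l x"
        unfolding H_def by (rule trig_sum_approx[OF f(1) B d(1) l])
      obtain C where C: "\<And>x. \<bar>g x\<bar> \<le> C" using trig_sum_bounded[OF g(1)] by blast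
      have close: "\<bar>(\<integral>x. f x \<partial>N) - (\<integral>x. g x \<partial>N)\<bar> \<le> d + 2 * B * (\<integral>x. H l x \<partial>N)"
        if N: "prob_space N" "sets N = sets borel" for N
      proof -
        interpret N: prob_space N by fact
        have gint: "integrable N g"
          using integrable_bounded_continuous[OF N trig_sum_continuous[OF g(1)] C] .
        note ints = fint[OF N] gint Hint[OF N l]
        have "\<bar>(\<integral>x. f x \<partial>N) - (\<integral>x. g x \<partial>N)\<bar> = \<bar>\<integral>x. f x - g x \<partial>N\<bar>"
          using ints by simp
        also have "\<dots> \<le> (\<integral>x. \<bar>f x - g x\<bar> \<partial>N)"
          by (rule integral_abs_bound)
        also have "\<dots> \<le> (\<integral>x. d + 2 * B * H l x \<partial>N)"
          using ints g(2) by (intro integral_mono) auto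
        also have "\<dots> = d + 2 * B * (\<integral>x. H l x \<partial>N)"
          using ints by (simp add: N.prob_space)
        finally show ?thesis .
      qed
      have "eventually (\<lambda>k. (\<integral>x. H l x \<partial>M k) < d) sequentially"
        using order_tendstoD(2)[OF Hlim[OF l]] j by (simp add: l_def)
      moreover have "eventually (\<lambda>k. dist (\<integral>x. g x \<partial>M k) (\<integral>x. g x \<partial>L) < d) sequentially"
        by (rule tendstoD[OF trig[OF g(1)] d(1)])
      ultimately show "eventually (\<lambda>k. dist (integral\<^sup>L (M k) f) (integral\<^sup>L L f) < e) sequentially"
      proof eventually_elim
        case (elim k)
        have "2 * B * (\<integral>x. H l x \<partial>M k) \<le> 2 * B * d" "2 * B * (\<integral>x. H l x \<partial>L) \<le> 2 * B * d"
          using elim(1) j B0 by (auto intro!: mult_left_mono simp: l_def)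
        moreover have "e = 3 * d + 2 * (2 * B * d)" using d(2) by (simp add: algebra_simps)
        ultimately show ?case
          using close[OF M(1,2), of k] close[OF L] elim(2) unfolding dist_real_def by linarith
      qed
    qed
  qed
qed

section \<open>Convergence of the greedy flow\<close>

context compactly_supported_law
begin

text \<open>If \<open>E h(\<theta> \<bullet> T\<^sub>k)\<close> exceeded the Gaussian value of \<open>h\<close>, then tilting the Gaussian in
  direction \<open>\<theta>\<close> by the factor \<open>1 + \<eta> (h - c)\<close> would be an available step of positive gain.\<close>

lemma ridge_upper_bound:
  fixes T :: "nat \<Rightarrow> real^'n \<Rightarrow> real^'n" and h :: "real \<Rightarrow> real"
  assumes T: "\<And>k. continuous_on UNIV (T k)" and b: "b \<longlonglongrightarrow> 0"
    and gain: "\<And>k \<Psi> R G. gaussianization_step \<Psi> R G \<Longrightarrow> expectation (\<lambda>x. G (T k x)) \<le> b k"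
    and \<theta>: "norm \<theta> = 1" and h: "continuous_on UNIV h" "bounded (range h)" and e: "0 < e"
  shows "eventually (\<lambda>k. expectation (\<lambda>x. h (\<theta> \<bullet> T k x)) < (\<integral>x. h (\<theta> \<bullet> x) \<partial>std_gaussian) + e) sequentially"
proof -
  interpret N: real_distribution std_normal_distribution
    by (rule std_normal_real_distribution)
  define c where "c = (\<integral>x. h x \<partial>std_normal_distribution)"
  have hm [measurable]: "h \<in> borel_measurable borel"
    by (rule borel_measurable_continuous_onI[OF h(1)])
  have c_eq: "(\<integral>x. h (\<theta> \<bullet> x) \<partial>std_gaussian) = c"
    unfolding c_def distr_std_gaussian_inner[OF \<theta>, symmetric] by (subst integral_distr) auto
  obtain B0 where B0: "\<And>x. \<bar>h x\<bar> \<le> B0" using h(2) by (auto simp: bounded_iff)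
  have hint: "integrable std_normal_distribution h"
    using B0 by (intro N.integrable_const_bound[where B=B0]) auto
  \<comment> \<open>The summand 1 keeps \<open>B\<close> positive for the divisions below.\<close>
  define B where "B = B0 + \<bar>c\<bar> + 1"
  have B: "0 < B" "\<And>x. \<bar>h x - c\<bar> \<le> B"
  proof -
    have "\<bar>h x - c\<bar> \<le> B" for x
      using B0[of x] abs_triangle_ineq4[of "h x" c] unfolding B_def by linarith
    moreover have "0 < B" using B0[of 0] unfolding B_def by linarith
    ultimately show "0 < B" "\<And>x. \<bar>h x - c\<bar> \<le> B" by auto
  qed
  \<comment> \<open>The first bound keeps the tilt within \<open>1 / 2\<close>, for positivity of
    \<open>v\<close> and the expansion of the logarithm; the second keeps the quadratic error, after
    division by \<open>\<eta>\<close>, below \<open>e / 2\<close>.\<close>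
  define \<eta> where "\<eta> = min (1 / (2 * B)) (e / (4 * B\<^sup>2))"
  have \<eta>: "0 < \<eta>" "\<eta> * B \<le> 1 / 2" "2 * \<eta> * B\<^sup>2 \<le> e / 2"
  proof -
    show "0 < \<eta>" using B e by (simp add: \<eta>_def)
    have "\<eta> \<le> 1 / (2 * B)" "\<eta> \<le> e / (4 * B\<^sup>2)" by (auto simp: \<eta>_def)
    then have "\<eta> * B \<le> 1 / (2 * B) * B" "\<eta> * (2 * B\<^sup>2) \<le> e / (4 * B\<^sup>2) * (2 * B\<^sup>2)"
      using B(1) by (intro mult_right_mono; simp)+
    then show "\<eta> * B \<le> 1 / 2" "2 * \<eta> * B\<^sup>2 \<le> e / 2"
      using B(1) by (simp_all add: mult.commute mult.left_commute)
  qed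
  \<comment> \<open>Centring \<open>h\<close> at its Gaussian mean \<open>c\<close> makes the tilted
    normal density integrate to 1.\<close>
  define v where "v x = 1 + \<eta> * (h x - c)" for x
  have u: "\<bar>\<eta> * (h x - c)\<bar> \<le> \<eta> * B" for x
    using \<eta>(1) B(2)[of x] by (simp add: abs_mult)
  have v_pos: "0 < v x" for x
    using u[of x] \<eta>(2) unfolding v_def by linarith
  have v_cont: "continuous_on UNIV v"
    unfolding v_def by (intro continuous_intros h)
  have [measurable]: "v \<in> borel_measurable borel"
    by (rule borel_measurable_continuous_onI[OF v_cont])
  have v_int: "(\<integral>\<^sup>+x. ennreal (std_normal_density x * v x) \<partial>lborel) = 1"
  proof -
    have "(\<integral>\<^sup>+x. ennreal (std_normal_density x * v x) \<partial>lborel) = (\<integral>\<^sup>+x. ennreal (v x) \<partial>std_normal_distribution)"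
      by (subst nn_integral_density) (auto simp: ennreal_mult v_pos less_imp_le)
    also have "\<dots> = ennreal (\<integral>x. v x \<partial>std_normal_distribution)"
      using hint by (intro nn_integral_eq_integral) (auto simp: v_def[abs_def] v_pos[unfolded v_def] less_imp_le)
    also have "(\<integral>x. v x \<partial>std_normal_distribution) = 1"
      unfolding v_def using hint N.prob_space by (simp add: c_def)
    finally show ?thesis by simp
  qed
  have ridge_cont: "continuous_on UNIV (\<lambda>x. g (\<theta> \<bullet> T k x))" if "continuous_on UNIV g" for g :: "real \<Rightarrow> real" and k
    by (rule continuous_on_compose2[OF that _ subset_UNIV]) (intro continuous_intros T)
  have bound: "expectation (\<lambda>x. h (\<theta> \<bullet> T k x)) - c \<le> b k / \<eta> + e / 2" for k
  proof -
    have "expectation (\<lambda>x. ln (v (\<theta> \<bullet> T k x))) \<le> b k"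
    proof (rule field_le_epsilon)
      fix d :: real assume "0 < d"
      obtain \<Psi> R G where "gaussianization_step \<Psi> R G"
        "expectation (\<lambda>x. ln (v (\<theta> \<bullet> T k x))) - d \<le> expectation (\<lambda>x. G (T k x))"
        by (rule gaussianization_step_direction[OF \<theta> T v_cont v_pos v_int \<open>0 < d\<close>])
      then show "expectation (\<lambda>x. ln (v (\<theta> \<bullet> T k x))) \<le> b k + d"
        using gain[of \<Psi> R G k] by linarith
    qed
    \<comment> \<open>This is \<open>ln (1 + u) \<ge> u - 2 * u^2\<close> for
      \<open>\<bar>u\<bar> \<le> 1 / 2\<close>: the gain is linear in the discrepancy of
      \<open>h\<close> up to a quadratic error.\<close>
    moreover have "expectation (\<lambda>x. \<eta> * (h (\<theta> \<bullet> T k x) - c) - 2 * (\<eta> * B)\<^sup>2) \<le> expectation (\<lambda>x. ln (v (\<theta> \<bullet> T k x)))"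
    proof (rule integral_mono)
      show "integrable \<mu> (\<lambda>x. \<eta> * (h (\<theta> \<bullet> T k x) - c) - 2 * (\<eta> * B)\<^sup>2)"
        by (intro integrable_continuous continuous_intros ridge_cont[OF h(1)])
      have "continuous_on UNIV (\<lambda>y. ln (v y))"
        using v_pos by (intro continuous_on_ln v_cont) (auto simp: less_imp_neq[symmetric])
      then show "integrable \<mu> (\<lambda>x. ln (v (\<theta> \<bullet> T k x)))"
        by (rule integrable_continuous[OF ridge_cont])
      fix x
      let ?u = "\<eta> * (h (\<theta> \<bullet> T k x) - c)"
      have "\<bar>ln (1 + ?u) - ?u\<bar> \<le> 2 * ?u\<^sup>2"
        using u[of "\<theta> \<bullet> T k x"] \<eta>(2) by (intro abs_ln_one_plus_x_minus_x_bound) linarith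
      moreover have "?u\<^sup>2 \<le> (\<eta> * B)\<^sup>2"
        using u[of "\<theta> \<bullet> T k x"] \<eta>(1) B(1) by (intro abs_le_square_iff[THEN iffD1]) simp
      ultimately show "?u - 2 * (\<eta> * B)\<^sup>2 \<le> ln (v (\<theta> \<bullet> T k x))"
        unfolding v_def by linarith
    qed
    moreover have "expectation (\<lambda>x. \<eta> * (h (\<theta> \<bullet> T k x) - c) - 2 * (\<eta> * B)\<^sup>2) =
        \<eta> * (expectation (\<lambda>x. h (\<theta> \<bullet> T k x)) - c) - 2 * (\<eta> * B)\<^sup>2"
      using integrable_continuous[OF ridge_cont[OF h(1)], of k] by (simp add: prob_space)
    ultimately have "\<eta> * (expectation (\<lambda>x. h (\<theta> \<bullet> T k x)) - c) \<le> b k + 2 * (\<eta> * B)\<^sup>2"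
      by linarith
    then have "expectation (\<lambda>x. h (\<theta> \<bullet> T k x)) - c \<le> (b k + 2 * (\<eta> * B)\<^sup>2) / \<eta>"
      using \<eta>(1) by (simp only: pos_le_divide_eq mult.commute)
    also have "\<dots> = b k / \<eta> + 2 * \<eta> * B\<^sup>2"
      using \<eta>(1) by (simp add: add_divide_distrib power2_eq_square)
    finally show ?thesis using \<eta>(3) by linarith
  qed
  have "(\<lambda>k. b k / \<eta>) \<longlonglongrightarrow> 0 / \<eta>"
    using \<eta>(1) by (intro tendsto_divide b tendsto_const) simp
  then have "eventually (\<lambda>k. b k / \<eta> < e / 2) sequentially"
    using e by (intro order_tendstoD(2)) auto
  then show ?thesis
  proof eventually_elim
    case (elim k)
    then show ?case using bound[of k] unfolding c_eq by linarith
  qed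
qed

lemma exists_convergent_flow:
  obtains \<Psi> R where "\<forall>k\<ge>1. marginal_gaussianization_layer (\<Psi> k) \<and> orthogonal_matrix (R k)"
    "conv_in_distribution (\<lambda>k. distr \<mu> borel (flow \<Psi> R k)) (std_gaussian :: (real^'n) measure)"
proof -
  obtain \<Psi> :: "nat \<Rightarrow> real^'n \<Rightarrow> real^'n" and R b
    where layers: "\<forall>k\<ge>1. marginal_gaussianization_layer (\<Psi> k) \<and> orthogonal_matrix (R k)"
    and T': "\<forall>k. continuous_on UNIV (flow \<Psi> R k)" and b: "b \<longlonglongrightarrow> 0"
    and gain: "\<forall>k \<Psi>' R' G'. gaussianization_step \<Psi>' R' G' \<longrightarrow> expectation (\<lambda>x. G' (flow \<Psi> R k x)) \<le> b k"
    by (rule greedy_flow)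
  note T = T'[rule_format]
  have Tm [measurable]: "flow \<Psi> R k \<in> borel_measurable borel" for k
    by (rule borel_measurable_continuous_onI[OF T])
  have "conv_in_distribution (\<lambda>k. distr \<mu> borel (flow \<Psi> R k)) std_gaussian"
  proof (rule conv_in_distribution_ridge)
    show "prob_space (distr \<mu> borel (flow \<Psi> R k))" for k
      by (rule prob_space_distr) measurable
    show "prob_space (std_gaussian :: (real^'n) measure)"
      by (rule prob_space_std_gaussian)
    fix \<theta> :: "real^'n" and h :: "real \<Rightarrow> real"
    assume \<theta>: "norm \<theta> = 1" and h: "continuous_on UNIV h" "bounded (range h)"
    have [measurable]: "h \<in> borel_measurable borel"
      by (rule borel_measurable_continuous_onI[OF h(1)])
    \<comment> \<open>The upper bound for \<open>- h\<close> is the matching lower bound for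
      \<open>h\<close>.\<close>
    have h': "continuous_on UNIV (\<lambda>y. - h y)" "bounded (range (\<lambda>y. - h y))"
      using h by (auto intro: continuous_intros simp: bounded_iff)
    have upper: "eventually (\<lambda>k. expectation (\<lambda>x. g (\<theta> \<bullet> flow \<Psi> R k x)) < (\<integral>x. g (\<theta> \<bullet> x) \<partial>std_gaussian) + e) sequentially"
      if "continuous_on UNIV g" "bounded (range g)" "0 < e" for g and e :: real
      by (rule ridge_upper_bound[OF T b _ \<theta> that]) (rule gain[rule_format])
    have "(\<lambda>k. expectation (\<lambda>x. h (\<theta> \<bullet> flow \<Psi> R k x))) \<longlonglongrightarrow> (\<integral>x. h (\<theta> \<bullet> x) \<partial>std_gaussian)"
    proof (rule tendstoI)
      fix e :: real assume e: "0 < e"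
      show "eventually (\<lambda>k. dist (expectation (\<lambda>x. h (\<theta> \<bullet> flow \<Psi> R k x)))
          (\<integral>x. h (\<theta> \<bullet> x) \<partial>std_gaussian) < e) sequentially"
        using upper[OF h e] upper[OF h' e]
      proof eventually_elim
        case (elim k)
        then show ?case
          unfolding dist_real_def Bochner_Integration.integral_minus by linarith
      qed
    qed
    moreover have "(\<integral>x. h (\<theta> \<bullet> x) \<partial>distr \<mu> borel (flow \<Psi> R k)) = expectation (\<lambda>x. h (\<theta> \<bullet> flow \<Psi> R k x))" for k
      by (rule integral_distr) measurable
    ultimately show "(\<lambda>k. \<integral>x. h (\<theta> \<bullet> x) \<partial>distr \<mu> borel (flow \<Psi> R k)) \<longlonglongrightarrow> (\<integral>x. h (\<theta> \<bullet> x) \<partial>std_gaussian)"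
      by (simp only:)
  qed simp_all
  with layers show ?thesis by (rule that)
qed

end

section \<open>Continuous densities on compact sets\<close>

theorem theorem1:
  fixes p :: "real^'n \<Rightarrow> real" and \<X> :: "(real^'n) set" and \<delta> :: real
  assumes "compact \<X>"
    and "\<delta> > 0"
    and "\<forall>x\<in>\<X>. \<delta> \<le> p x"
    and "\<forall>x. x \<notin> \<X> \<longrightarrow> p x = 0"
    and "continuous_on \<X> p"
    and "(\<integral>\<^sup>+ x. ennreal (p x) \<partial>lborel) = 1"
  shows "\<exists>(\<Psi> :: nat \<Rightarrow> real^'n \<Rightarrow> real^'n) (R :: nat \<Rightarrow> real^'n^'n).
           (\<forall>k\<ge>1. marginal_gaussianization_layer (\<Psi> k) \<and> orthogonal_matrix (R k)) \<and>
           conv_in_distribution (\<lambda>k. distr (density lborel p) borel (flow \<Psi> R k)) std_gaussian"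
proof -
  define \<mu> where "\<mu> = density lborel (\<lambda>x. ennreal (p x))"
  define \<gamma> where "\<gamma> x = (\<Prod>i\<in>UNIV. std_normal_density (x $ i))" for x :: "real^'n"
  have X [measurable]: "\<X> \<in> sets borel"
    by (rule borel_compact[OF assms(1)])
  \<comment> \<open>Continuity is given on \<open>\<X>\<close> only, so measurability of
    \<open>p\<close> comes from its being the extension by zero of a continuous function on a Borel
    set.\<close>
  have "(\<lambda>x. indicator \<X> x *\<^sub>R p x) \<in> borel_measurable borel"
    by (rule borel_measurable_continuous_on_indicator[OF X assms(5)])
  moreover have "(\<lambda>x. indicator \<X> x *\<^sub>R p x) = p"
  proof
    show "indicator \<X> x *\<^sub>R p x = p x" for x
      using assms(4) by (cases "x \<in> \<X>") simp_all
  qed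
  ultimately have [measurable]: "p \<in> borel_measurable borel" by (simp only:)
  have \<gamma>_pos: "0 < \<gamma> x" for x
    unfolding \<gamma>_def by (intro prod_pos normal_density_pos) simp
  have \<gamma>_cont: "continuous_on UNIV \<gamma>"
    unfolding \<gamma>_def std_normal_density_prod by (intro continuous_intros) auto
  have [measurable]: "\<gamma> \<in> borel_measurable borel"
    by (rule borel_measurable_continuous_onI[OF \<gamma>_cont])
  \<comment> \<open>The density ratio to the Gaussian is continuous on a compact set, hence bounded;
    this yields the domination constant. Its absolute value is taken so that it is nonnegative
    whatever bound was obtained.\<close>
  have "continuous_on \<X> (\<lambda>x. p x / \<gamma> x)"
    using \<gamma>_pos by (intro continuous_on_divide assms(5) continuous_on_subset[OF \<gamma>_cont])
      (auto simp: less_imp_neq[symmetric])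
  then have "bounded ((\<lambda>x. p x / \<gamma> x) ` \<X>)"
    by (intro compact_imp_bounded compact_continuous_image assms(1))
  then obtain Q where Q: "\<And>x. x \<in> \<X> \<Longrightarrow> \<bar>p x / \<gamma> x\<bar> \<le> Q"
    by (auto simp: bounded_iff)
  have p_le: "p x \<le> \<bar>Q\<bar> * \<gamma> x" for x
  proof (cases "x \<in> \<X>")
    case True
    then have "p x / \<gamma> x \<le> \<bar>Q\<bar>" using Q[of x] by linarith
    then show ?thesis using \<gamma>_pos[of x] by (simp add: pos_divide_le_eq)
  next
    case False
    then show ?thesis using assms(4) \<gamma>_pos[of x] by (simp add: less_imp_le)
  qed
  interpret prob_space \<mu>
    by (rule prob_spaceI) (simp add: \<mu>_def emeasure_density assms(6))
  interpret compactly_supported_law \<mu> \<X> "\<bar>Q\<bar>"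
  proof
    show "sets \<mu> = sets borel" by (simp add: \<mu>_def)
    show "compact \<X>" by (rule assms(1))
    show "0 \<le> \<bar>Q\<bar>" by simp
    show "AE x in \<mu>. x \<in> \<X>"
      unfolding \<mu>_def using assms(4) by (subst AE_density) (auto intro!: AE_I2)
    fix H :: "real^'n \<Rightarrow> ennreal" assume [measurable]: "H \<in> borel_measurable borel"
    have "(\<integral>\<^sup>+x. H x \<partial>\<mu>) = (\<integral>\<^sup>+x. ennreal (p x) * H x \<partial>lborel)"
      unfolding \<mu>_def by (rule nn_integral_density) auto
    also have "\<dots> \<le> (\<integral>\<^sup>+x. ennreal \<bar>Q\<bar> * (ennreal (\<gamma> x) * H x) \<partial>lborel)"
    proof (rule nn_integral_mono)
      fix x
      have "ennreal (p x) \<le> ennreal \<bar>Q\<bar> * ennreal (\<gamma> x)"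
        using p_le[of x] \<gamma>_pos[of x] by (simp add: ennreal_mult[symmetric] ennreal_leI)
      then show "ennreal (p x) * H x \<le> ennreal \<bar>Q\<bar> * (ennreal (\<gamma> x) * H x)"
        unfolding mult.assoc[symmetric] by (rule mult_right_mono) simp
    qed
    also have "\<dots> = ennreal \<bar>Q\<bar> * (\<integral>\<^sup>+x. ennreal (\<gamma> x) * H x \<partial>lborel)"
      by (rule nn_integral_cmult) measurable
    also have "\<dots> = ennreal \<bar>Q\<bar> * (\<integral>\<^sup>+x. H x \<partial>std_gaussian)"
      unfolding std_gaussian_def \<gamma>_def by (subst nn_integral_density) auto
    finally show "(\<integral>\<^sup>+x. H x \<partial>\<mu>) \<le> ennreal \<bar>Q\<bar> * (\<integral>\<^sup>+x. H x \<partial>std_gaussian)" .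
  qed
  obtain \<Psi> R where "\<forall>k\<ge>1. marginal_gaussianization_layer (\<Psi> k) \<and> orthogonal_matrix (R k)"
    "conv_in_distribution (\<lambda>k. distr \<mu> borel (flow \<Psi> R k)) (std_gaussian :: (real^'n) measure)"
    by (rule exists_convergent_flow)
  then have "(\<forall>k\<ge>1. marginal_gaussianization_layer (\<Psi> k) \<and> orthogonal_matrix (R k)) \<and>
      conv_in_distribution (\<lambda>k. distr (density lborel p) borel (flow \<Psi> R k)) std_gaussian"
    unfolding \<mu>_def by (rule conjI)
  then show ?thesis
    by (rule exI[of _ R, THEN exI[of _ \<Psi>]])
qed

end
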